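(* Let $\mathcal D$ be a triangulated category, $\Gamma$ a free abelian group of finite rank and $\operatorname{cl}:K(\mathcal D)\to\Gamma$ a linear map. Let $M$ be a path-connected topological space, let $(\sigma_x=(Z_x,\mathcal P_x))_{x\in M}$ be a continuous family of stability conditions on $\mathcal D$ (with respect to $\operatorname{cl}$), and let $Q:\Gamma_{\mathbb R}\to\mathbb R$ be a quadratic form that is negative semi-definite on $\operatorname{Ker}(Z_x:\Gamma_{\mathbb R}\to\mathbb C)$ for all $x\in M$. If there exists $x\in M$ such that $Q(\operatorname{cl}E)\ge0$ for all $\sigma_x$-semistable objects $E$, then for every $y\in M$ we have $Q(\operatorname{cl}E)\ge0$ for all $\sigma_y$-semistable objects $E$.
   Context: $K(\mathcal D)$ is the Grothendieck group of $\mathcal D$, $\Gamma_{\mathbb R}=\Gamma\otimes_{\mathbb Z}\mathbb R$ is equipped with a norm $\|\cdot\|$. A slicing $\mathcal P=(\mathcal P_\varphi)_{\varphi\in\mathbb R}$ of $\mathcal D$ is a collection of full subcategories such that (i) $\mathcal P_{\varphi+1}=\mathcal P_\varphi[1]$; (ii) $\operatorname{Hom}(\mathcal P_\varphi,\mathcal P_{\varphi'})=0$ for $\varphi>\varphi'$; (iii) every $0\ne E\in\mathcal D$ has a (Harder–Narasimhan) filtration $0=E_0\to E_1\to\dots\to E_n=E$ with $\operatorname{cone}(E_{k-1}\to E_k)\in\mathcal P_{\varphi_k}$ (nonzero) and $\varphi_1>\dots>\varphi_n$. One puts $\varphi^+_{\mathcal P}(E)=\varphi_1$, $\varphi^-_{\mathcal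 P}(E)=\varphi_n$. A stability condition on $\mathcal D$ (with respect to $\operatorname{cl}$) is a pair $\sigma=(Z,\mathcal P)$ where $Z:\Gamma\to\mathbb C$ is linear and $\mathcal P$ is a slicing such that $Z(E):=Z(\operatorname{cl}E)\in\mathbb R_{>0}e^{i\pi\varphi}$ for all $0\ne E\in\mathcal P_\varphi$, and such that there exists $\varepsilon>0$ with $|Z(E)|\ge\varepsilon\|\operatorname{cl}E\|$ for all $\sigma$-semistable $E$ (support property). Nonzero objects of $\mathcal P_\varphi$ ($\varphi\in\mathbb R$) are called $\sigma$-semistable. The distance between slicings is $d(\mathcal P,\mathcal Q)=\sup_{0\ne E\in\mathcal D}\{|\varphi^+_{\mathcal P}(E)-\varphi^+_{\mathcal Q}(E)|,\,|\varphi^-_{\mathcal P}(E)-\varphi^-_{\mathcal Q}(E)|\}$. A family of stability conditions $(\sigma_x=(Z_x,\mathcal P_x))_{x\in M}$ is continuous if $M\to\operatorname{Hom}(\Gamma,\mathbb C)$, $x\mapsto Z_x$, is continuous and for any $x\in M$ and $\varepsilon>0$ there is a neighborhood $U$ of $x$ with $d(\mathcal P_x,\mathcal P_y)<\varepsilon$ for all $y\in U$. *)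

theory Defs
  imports "HOL-Analysis.Analysis" "HOL-Algebra.Free_Abelian_Groups" "HOL-Algebra.Generated_Groups"
begin

section \<open>Triangulated categories\<close>

text \<open>
  Objects and morphisms are values of two types.  Hom-sets \<open>Mor X Y\<close> are indexed by source and
  target and are not required to be disjoint, so a distinguished triangle
  \<open>X \<rightarrow> Y \<rightarrow> Z \<rightarrow> X[1]\<close> is recorded together with its three objects.
\<close>

record ('o, 'm) tri_cat =
  Ob :: "'o set"
  Mor :: "'o \<Rightarrow> 'o \<Rightarrow> 'm set"
  Idt :: "'o \<Rightarrow> 'm"
  Cmp :: "'m \<Rightarrow> 'm \<Rightarrow> 'm" (infixl \<open>\<cdot>\<index>\<close> 70)
  Add :: "'m \<Rightarrow> 'm \<Rightarrow> 'm"
  Zero_mor :: "'o \<Rightarrow> 'o \<Rightarrow> 'm"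
  Sh :: "'o \<Rightarrow> 'o"
  Sh_mor :: "'m \<Rightarrow> 'm"
  Dist :: "'o \<Rightarrow> 'o \<Rightarrow> 'o \<Rightarrow> 'm \<Rightarrow> 'm \<Rightarrow> 'm \<Rightarrow> bool"

definition iso_mor :: "('o, 'm) tri_cat \<Rightarrow> 'o \<Rightarrow> 'o \<Rightarrow> 'm \<Rightarrow> bool" where
  "iso_mor D X Y f \<longleftrightarrow>
     f \<in> Mor D X Y \<and> (\<exists>g \<in> Mor D Y X. g \<cdot>\<^bsub>D\<^esub> f = Idt D X \<and> f \<cdot>\<^bsub>D\<^esub> g = Idt D Y)"

definition iso_closure :: "('o, 'm) tri_cat \<Rightarrow> 'o set \<Rightarrow> 'o set" where
  "iso_closure D S = {Y \<in> Ob D. \<exists>X \<in> S. \<exists>f. iso_mor D X Y f}"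

definition zero_object :: "('o, 'm) tri_cat \<Rightarrow> 'o \<Rightarrow> bool" where
  "zero_object D X \<longleftrightarrow>
     X \<in> Ob D \<and> (\<forall>Y \<in> Ob D. (\<exists>!f. f \<in> Mor D X Y) \<and> (\<exists>!f. f \<in> Mor D Y X))"

definition hom_group :: "('o, 'm) tri_cat \<Rightarrow> 'o \<Rightarrow> 'o \<Rightarrow> 'm monoid" where
  "hom_group D X Y = \<lparr>carrier = Mor D X Y, mult = Add D, one = Zero_mor D X Y\<rparr>"

locale category =
  fixes D :: "('o, 'm) tri_cat" (structure)
  assumes Idt_in: "X \<in> Ob D \<Longrightarrow> Idt D X \<in> Mor D X X"
    and Cmp_in: "\<lbrakk>X \<in> Ob D; Y \<in> Ob D; Z \<in> Ob D; f \<in> Mor D X Y; g \<in> Mor D Y Z\<rbrakk>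
      \<Longrightarrow> g \<cdot> f \<in> Mor D X Z"
    and Cmp_Idt: "\<lbrakk>X \<in> Ob D; Y \<in> Ob D; f \<in> Mor D X Y\<rbrakk> \<Longrightarrow> f \<cdot> Idt D X = f"
    and Idt_Cmp: "\<lbrakk>X \<in> Ob D; Y \<in> Ob D; f \<in> Mor D X Y\<rbrakk> \<Longrightarrow> Idt D Y \<cdot> f = f"
    and Cmp_assoc: "\<lbrakk>W \<in> Ob D; X \<in> Ob D; Y \<in> Ob D; Z \<in> Ob D;
        f \<in> Mor D W X; g \<in> Mor D X Y; h \<in> Mor D Y Z\<rbrakk> \<Longrightarrow> h \<cdot> (g \<cdot> f) = (h \<cdot> g) \<cdot> f"

locale additive_category = category +
  assumes hom_group: "\<lbrakk>X \<in> Ob D; Y \<in> Ob D\<rbrakk> \<Longrightarrow> comm_group (hom_group D X Y)"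
    and Cmp_Add_left: "\<lbrakk>X \<in> Ob D; Y \<in> Ob D; Z \<in> Ob D;
        f \<in> Mor D X Y; g \<in> Mor D Y Z; g' \<in> Mor D Y Z\<rbrakk>
      \<Longrightarrow> Add D g g' \<cdot> f = Add D (g \<cdot> f) (g' \<cdot> f)"
    and Cmp_Add_right: "\<lbrakk>X \<in> Ob D; Y \<in> Ob D; Z \<in> Ob D;
        f \<in> Mor D X Y; f' \<in> Mor D X Y; g \<in> Mor D Y Z\<rbrakk>
      \<Longrightarrow> g \<cdot> Add D f f' = Add D (g \<cdot> f) (g \<cdot> f')"
    and zero_object_exists: "\<exists>X. zero_object D X"
    and biproduct_exists: "\<lbrakk>X \<in> Ob D; Y \<in> Ob D\<rbrakk> \<Longrightarrow>
        \<exists>B \<in> Ob D. \<exists>i \<in> Mor D X B. \<exists>j \<in> Mor D Y B. \<exists>p \<in> Mor D B X. \<exists>q \<in> Mor D B Y.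
          p \<cdot> i = Idt D X \<and> q \<cdot> j = Idt D Y \<and> p \<cdot> j = Zero_mor D Y X \<and> q \<cdot> i = Zero_mor D X Y \<and>
          Add D (i \<cdot> p) (j \<cdot> q) = Idt D B"

text \<open>
  The shift \<open>[1]\<close> is an additive autoequivalence; an automorphism of categories is a special case.
\<close>

locale triangulated_category = additive_category +
  assumes Sh_in: "X \<in> Ob D \<Longrightarrow> Sh D X \<in> Ob D"
    and Sh_mor_bij: "\<lbrakk>X \<in> Ob D; Y \<in> Ob D\<rbrakk>
      \<Longrightarrow> bij_betw (Sh_mor D) (Mor D X Y) (Mor D (Sh D X) (Sh D Y))"
    and Sh_Idt: "X \<in> Ob D \<Longrightarrow> Sh_mor D (Idt D X) = Idt D (Sh D X)"
    and Sh_Cmp: "\<lbrakk>X \<in> Ob D; Y \<in> Ob D; Z \<in> Ob D; f \<in> Mor D X Y; g \<in> Mor D Y Z\<rbrakk>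
      \<Longrightarrow> Sh_mor D (g \<cdot> f) = Sh_mor D g \<cdot> Sh_mor D f"
    and Sh_Add: "\<lbrakk>X \<in> Ob D; Y \<in> Ob D; f \<in> Mor D X Y; g \<in> Mor D X Y\<rbrakk>
      \<Longrightarrow> Sh_mor D (Add D f g) = Add D (Sh_mor D f) (Sh_mor D g)"
    and Sh_ess_surj: "Y \<in> Ob D \<Longrightarrow> \<exists>X \<in> Ob D. \<exists>f. iso_mor D (Sh D X) Y f"
    and Dist_in: "Dist D X Y Z f g h \<Longrightarrow>
        X \<in> Ob D \<and> Y \<in> Ob D \<and> Z \<in> Ob D \<and>
        f \<in> Mor D X Y \<and> g \<in> Mor D Y Z \<and> h \<in> Mor D Z (Sh D X)"
    and TR1_Idt: "\<lbrakk>X \<in> Ob D; zero_object D N\<rbrakk>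
      \<Longrightarrow> Dist D X X N (Idt D X) (Zero_mor D X N) (Zero_mor D N (Sh D X))"
    and TR1_iso: "\<lbrakk>Dist D X Y Z f g h; X' \<in> Ob D; Y' \<in> Ob D; Z' \<in> Ob D;
        f' \<in> Mor D X' Y'; g' \<in> Mor D Y' Z'; h' \<in> Mor D Z' (Sh D X');
        iso_mor D X X' a; iso_mor D Y Y' b; iso_mor D Z Z' c;
        b \<cdot> f = f' \<cdot> a; c \<cdot> g = g' \<cdot> b; Sh_mor D a \<cdot> h = h' \<cdot> c\<rbrakk>
      \<Longrightarrow> Dist D X' Y' Z' f' g' h'"
    and TR1_cone: "\<lbrakk>X \<in> Ob D; Y \<in> Ob D; f \<in> Mor D X Y\<rbrakk> \<Longrightarrow> \<exists>Z g h. Dist D X Y Z f g h"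
    and TR2: "\<lbrakk>X \<in> Ob D; Y \<in> Ob D; Z \<in> Ob D;
        f \<in> Mor D X Y; g \<in> Mor D Y Z; h \<in> Mor D Z (Sh D X)\<rbrakk>
      \<Longrightarrow> Dist D X Y Z f g h \<longleftrightarrow>
          Dist D Y Z (Sh D X) g h (inv\<^bsub>hom_group D (Sh D X) (Sh D Y)\<^esub> (Sh_mor D f))"
    and TR3: "\<lbrakk>Dist D X Y Z f g h; Dist D X' Y' Z' f' g' h';
        a \<in> Mor D X X'; b \<in> Mor D Y Y'; b \<cdot> f = f' \<cdot> a\<rbrakk>
      \<Longrightarrow> \<exists>c \<in> Mor D Z Z'. c \<cdot> g = g' \<cdot> b \<and> Sh_mor D a \<cdot> h = h' \<cdot> c"
    and TR4: "\<lbrakk>Dist D X Y A f f1 f2; Dist D Y Z C g g1 g2; Dist D X Z B (g \<cdot> f) h1 h2\<rbrakk>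
      \<Longrightarrow> \<exists>u v. Dist D A B C u v (Sh_mor D f1 \<cdot> g2) \<and>
            u \<cdot> f1 = h1 \<cdot> g \<and> h2 \<cdot> u = f2 \<and> v \<cdot> h1 = g1 \<and> g2 \<cdot> v = Sh_mor D f \<cdot> h2"

section \<open>Grothendieck group\<close>

text \<open>
  The free abelian group on the objects modulo \<open>[Y] = [X] + [Z]\<close> for every distinguished triangle
  \<open>X \<rightarrow> Y \<rightarrow> Z \<rightarrow> X[1]\<close>; isomorphic objects are identified by these relations.
\<close>

definition K_relations :: "('o, 'm) tri_cat \<Rightarrow> ('o \<Rightarrow>\<^sub>0 int) set" where
  "K_relations D = generate (free_Abelian_group (Ob D))
     {frag_of Y - frag_of X - frag_of Z | X Y Z. \<exists>f g h. Dist D X Y Z f g h}"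

definition K_group :: "('o, 'm) tri_cat \<Rightarrow> ('o \<Rightarrow>\<^sub>0 int) set monoid" where
  "K_group D = free_Abelian_group (Ob D) Mod K_relations D"

definition K_class :: "('o, 'm) tri_cat \<Rightarrow> 'o \<Rightarrow> ('o \<Rightarrow>\<^sub>0 int) set" where
  "K_class D E = K_relations D #>\<^bsub>free_Abelian_group (Ob D)\<^esub> frag_of E"

section \<open>The lattice and its real extension\<close>

text \<open>The abelian group \<open>\<Gamma>\<close> is a type of class \<^class>\<open>ab_group_add\<close>.\<close>

definition type_group :: "'g::ab_group_add monoid" where
  "type_group = \<lparr>carrier = UNIV, mult = (+), one = 0\<rparr>"

definition free_of_finite_rank :: "'g::ab_group_add itself \<Rightarrow> bool" where
  "free_of_finite_rank _ \<longleftrightarrow> (\<exists>n::nat. (type_group :: 'g monoid) \<cong> free_Abelian_group {..<n})"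

text \<open>
  \<open>\<Gamma> \<otimes>\<^sub>\<int> \<real>\<close>: finitely supported functions \<open>\<Gamma> \<rightarrow> \<real>\<close>, in which \<open>single g r\<close> represents
  \<open>g \<otimes> r\<close>, modulo additivity in the first argument.  Additivity in the second argument already
  holds before passing to the quotient.
\<close>

inductive_set tensor_relations :: "('g::ab_group_add \<Rightarrow>\<^sub>0 real) set" where
  zero: "0 \<in> tensor_relations"
| gen: "Poly_Mapping.single (g + h) r - Poly_Mapping.single g r - Poly_Mapping.single h r
    \<in> tensor_relations"
| diff: "\<lbrakk>p \<in> tensor_relations; q \<in> tensor_relations\<rbrakk> \<Longrightarrow> p - q \<in> tensor_relations"

lemma tensor_relations_uminus: "p \<in> tensor_relations \<Longrightarrow> - p \<in> tensor_relations"
  using tensor_relations.diff[OF tensor_relations.zero, of p] by simp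

lemma tensor_relations_add:
  "\<lbrakk>p \<in> tensor_relations; q \<in> tensor_relations\<rbrakk> \<Longrightarrow> p + q \<in> tensor_relations"
  using tensor_relations.diff[OF _ tensor_relations_uminus, of p q] by simp

quotient_type (overloaded) 'g realification =
  "'g::ab_group_add \<Rightarrow>\<^sub>0 real" / "\<lambda>p q. p - q \<in> tensor_relations"
proof (rule equivpI)
  show "reflp (\<lambda>p q. p - q \<in> (tensor_relations :: ('g \<Rightarrow>\<^sub>0 real) set))"
    by (auto intro!: reflpI tensor_relations.zero)
  show "symp (\<lambda>p q. p - q \<in> (tensor_relations :: ('g \<Rightarrow>\<^sub>0 real) set))"
    by (rule sympI) (use tensor_relations_uminus in fastforce)
  show "transp (\<lambda>p q. p - q \<in> (tensor_relations :: ('g \<Rightarrow>\<^sub>0 real) set))"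
    by (rule transpI) (use tensor_relations_add in fastforce)
qed

definition pm_scale :: "real \<Rightarrow> ('g \<Rightarrow>\<^sub>0 real) \<Rightarrow> ('g \<Rightarrow>\<^sub>0 real)" where
  "pm_scale r = Poly_Mapping.map (\<lambda>s. r * s)"

lemma lookup_pm_scale [simp]:
  "Poly_Mapping.lookup (pm_scale r p) g = r * Poly_Mapping.lookup p g"
  by (simp add: pm_scale_def Poly_Mapping.map.rep_eq when_def)

lemma pm_scale_add: "pm_scale r (p + q) = pm_scale r p + pm_scale r q"
  and pm_scale_diff: "pm_scale r (p - q) = pm_scale r p - pm_scale r q"
  and pm_scale_add_left: "pm_scale (r + s) p = pm_scale r p + pm_scale s p"
  and pm_scale_scale: "pm_scale r (pm_scale s p) = pm_scale (r * s) p"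
  and pm_scale_one: "pm_scale 1 p = p"
  and pm_scale_zero: "pm_scale r 0 = 0"
  and pm_scale_single: "pm_scale r (Poly_Mapping.single g s) = Poly_Mapping.single g (r * s)"
  by (auto intro!: poly_mapping_eqI simp: lookup_add lookup_minus lookup_single algebra_simps when_def)

lemma pm_scale_relations: "p \<in> tensor_relations \<Longrightarrow> pm_scale r p \<in> tensor_relations"
  by (induction rule: tensor_relations.induct)
    (auto simp: pm_scale_diff pm_scale_zero pm_scale_single intro: tensor_relations.intros)

instantiation realification :: (ab_group_add) real_vector
begin

lift_definition zero_realification :: "'a realification" is 0 .

lift_definition plus_realification :: "'a realification \<Rightarrow> 'a realification \<Rightarrow> 'a realification"
  is "(+)" by (metis add_diff_add tensor_relations_add)

lift_definition minus_realification :: "'a realification \<Rightarrow> 'a realification \<Rightarrow> 'a realification"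
  is "(-)"
proof -
  fix p p' q q' :: "'a \<Rightarrow>\<^sub>0 real"
  assume "p - p' \<in> tensor_relations" "q - q' \<in> tensor_relations"
  then have "(p - p') - (q - q') \<in> tensor_relations" by (rule tensor_relations.diff)
  then show "(p - q) - (p' - q') \<in> tensor_relations" by (simp add: algebra_simps)
qed

lift_definition uminus_realification :: "'a realification \<Rightarrow> 'a realification" is uminus
  using tensor_relations_uminus by fastforce

lift_definition scaleR_realification :: "real \<Rightarrow> 'a realification \<Rightarrow> 'a realification"
  is pm_scale by (metis pm_scale_diff pm_scale_relations)

instance
  by standard
    (transfer, simp add: algebra_simps tensor_relations.zero pm_scale_add pm_scale_add_left
      pm_scale_scale pm_scale_one)+

end

lift_definition tensor :: "'g::ab_group_add \<Rightarrow> real \<Rightarrow> 'g realification" is Poly_Mapping.single .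

lemma tensor_add_left: "tensor (g + h) r = tensor g r + tensor h r"
  by transfer (use tensor_relations.gen in \<open>simp add: algebra_simps\<close>)

lemma tensor_add_right: "tensor g (r + s) = tensor g r + tensor g s"
  by transfer (simp add: single_add tensor_relations.zero)

lemma scaleR_tensor: "s *\<^sub>R tensor g r = tensor g (s * r)"
  by transfer (simp add: pm_scale_single tensor_relations.zero)

abbreviation lattice_incl :: "'g::ab_group_add \<Rightarrow> 'g realification" where
  "lattice_incl g \<equiv> tensor g 1"

lemma span_lattice_incl: "span (range lattice_incl) = (UNIV :: 'g::ab_group_add realification set)"
proof -
  have "abs_realification p \<in> span (range lattice_incl)" for p :: "'g \<Rightarrow>\<^sub>0 real"
  proof (induction p rule: update_induct)
    case const
    show ?case by (metis zero_realification.abs_eq span_zero)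
  next
    case (update p g r)
    have "Poly_Mapping.update g r p = p + Poly_Mapping.single g r"
      using update(1) by (auto intro!: poly_mapping_eqI
          simp: lookup_update lookup_add lookup_single in_keys_iff when_def)
    moreover have "abs_realification (Poly_Mapping.single g r) = r *\<^sub>R lattice_incl g"
      by (simp add: scaleR_tensor) (simp add: tensor.abs_eq)
    ultimately have "abs_realification (Poly_Mapping.update g r p) =
        abs_realification p + r *\<^sub>R lattice_incl g"
      by (metis plus_realification.abs_eq)
    moreover have "r *\<^sub>R lattice_incl g \<in> span (range lattice_incl)"
      by (intro span_scale span_base rangeI)
    ultimately show ?case
      using update(3) by (simp only: span_add)
  qed
  then have "v \<in> span (range lattice_incl)" for v :: "'g realification"
    by (induction v rule: realification.abs_induct)
  then show ?thesis by blast
qed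

text \<open>The \<open>\<real>\<close>-linear extension \<open>\<Gamma>\<^sub>\<real> \<rightarrow> \<complex>\<close> of an additive map \<open>\<Gamma> \<rightarrow> \<complex>\<close>.\<close>

definition real_extension :: "('g::ab_group_add \<Rightarrow> complex) \<Rightarrow> 'g realification \<Rightarrow> complex" where
  "real_extension Z = (THE F. linear F \<and> (\<forall>g. F (lattice_incl g) = Z g))"

lemma real_extension_unique_exists:
  fixes Z :: "'g::ab_group_add \<Rightarrow> complex"
  assumes "Modules.additive Z"
  shows "\<exists>!F. linear F \<and> (\<forall>g. F (lattice_incl g) = Z g)"
proof -
  define L :: "('g \<Rightarrow>\<^sub>0 real) \<Rightarrow> complex" where
    "L p = (\<Sum>g\<in>Poly_Mapping.keys p. Poly_Mapping.lookup p g *\<^sub>R Z g)" for p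
  have L_sup: "L p = (\<Sum>g\<in>A. Poly_Mapping.lookup p g *\<^sub>R Z g)"
    if "finite A" "Poly_Mapping.keys p \<subseteq> A" for p A
    unfolding L_def using that by (intro sum.mono_neutral_left) (auto simp: in_keys_iff)
  have L_diff: "L (p - q) = L p - L q" for p q
  proof -
    let ?A = "Poly_Mapping.keys p \<union> Poly_Mapping.keys q"
    have "Poly_Mapping.keys (p - q) \<subseteq> ?A" by (auto simp: in_keys_iff lookup_minus)
    then show ?thesis
      using L_sup[of ?A p] L_sup[of ?A q] L_sup[of ?A "p - q"]
      by (simp add: lookup_minus scaleR_diff_left sum_subtractf)
  qed
  have L_0: "L 0 = 0" by (simp add: L_def)
  have L_single: "L (Poly_Mapping.single g r) = r *\<^sub>R Z g" for g r
    using L_sup[of "{g}" "Poly_Mapping.single g r"] by simp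
  have L_scale: "L (pm_scale r p) = r *\<^sub>R L p" for r p
  proof -
    have "Poly_Mapping.keys (pm_scale r p) \<subseteq> Poly_Mapping.keys p" by (auto simp: in_keys_iff)
    then show ?thesis
      using L_sup[of "Poly_Mapping.keys p" "pm_scale r p"] L_sup[of "Poly_Mapping.keys p" p]
      by (simp add: scaleR_sum_right)
  qed
  have L_rel: "L p = 0" if "p \<in> tensor_relations" for p
    using that
    by (induction rule: tensor_relations.induct)
      (auto simp: L_0 L_diff L_single Modules.additive.add[OF assms] scaleR_add_right)
  define F where "F v = L (rep_realification v)" for v
  have F_abs: "F (abs_realification p) = L p" for p
  proof -
    have "rep_realification (abs_realification p) - p \<in> tensor_relations"
      using Quotient3_rep_abs[OF Quotient3_realification, of p] tensor_relations.zero by simp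
    from L_rel[OF this] show ?thesis by (simp add: F_def L_diff)
  qed
  have L_add: "L (p + q) = L p + L q" for p q
    using L_diff[of "p + q" q] by simp
  have "linear F"
  proof (rule linearI)
    show "F (v + w) = F v + F w" for v w
      by (induction v rule: realification.abs_induct, induction w rule: realification.abs_induct)
        (simp add: plus_realification.abs_eq F_abs L_add)
    show "F (r *\<^sub>R v) = r *\<^sub>R F v" for r v
      by (induction v rule: realification.abs_induct)
        (simp add: scaleR_realification.abs_eq F_abs L_scale)
  qed
  moreover have "F (lattice_incl g) = Z g" for g
    by (simp add: tensor.abs_eq F_abs L_single)
  moreover have "G = H"
    if GH: "linear G \<and> (\<forall>g. G (lattice_incl g) = Z g)" "linear H \<and> (\<forall>g. H (lattice_incl g) = Z g)"
    for G H
  proof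
    fix v :: "'g realification"
    have "v \<in> span (range lattice_incl)" by (simp add: span_lattice_incl)
    moreover have "linear G" "linear H" using GH by blast+
    moreover have "G w = H w" if "w \<in> range lattice_incl" for w
      using that GH by auto
    ultimately show "G v = H v"
      using linear_eq_on_span by blast
  qed
  ultimately show ?thesis by blast
qed

definition is_norm :: "('v::real_vector \<Rightarrow> real) \<Rightarrow> bool" where
  "is_norm N \<longleftrightarrow>
     (\<forall>v. 0 \<le> N v) \<and> (\<forall>v. N v = 0 \<longleftrightarrow> v = 0) \<and>
     (\<forall>v w. N (v + w) \<le> N v + N w) \<and> (\<forall>r v. N (r *\<^sub>R v) = \<bar>r\<bar> * N v)"

definition quadratic_form :: "('v::real_vector \<Rightarrow> real) \<Rightarrow> bool" where
  "quadratic_form Q \<longleftrightarrow> (\<exists>b. bilinear b \<and> (\<forall>v w. b v w = b w v) \<and> (\<forall>v. Q v = b v v))"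

section \<open>Slicings\<close>

text \<open>A full subcategory is given by its set of objects.\<close>

type_synonym 'o slicing = "real \<Rightarrow> 'o set"

text \<open>
  The filtration \<open>0 = E 0 \<rightarrow> E 1 \<rightarrow> \<dots> \<rightarrow> E n = X\<close> with maps \<open>f k : E (k - 1) \<rightarrow> E k\<close> and cones
  \<open>A k\<close> of phase \<open>\<phi> k\<close>, for \<open>1 \<le> k \<le> n\<close>.
\<close>

definition HN_filtration ::
  "('o, 'm) tri_cat \<Rightarrow> 'o slicing \<Rightarrow> 'o \<Rightarrow> nat \<Rightarrow>
   (nat \<Rightarrow> 'o) \<Rightarrow> (nat \<Rightarrow> 'm) \<Rightarrow> (nat \<Rightarrow> 'o) \<Rightarrow> (nat \<Rightarrow> real) \<Rightarrow> bool" where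
  "HN_filtration D P X n E f A \<phi> \<longleftrightarrow>
     zero_object D (E 0) \<and> E n = X \<and>
     (\<forall>k \<in> {1..n}. (\<exists>g h. Dist D (E (k - 1)) (E k) (A k) (f k) g h) \<and>
        A k \<in> P (\<phi> k) \<and> \<not> zero_object D (A k)) \<and>
     (\<forall>k \<in> {1..n}. \<forall>l \<in> {1..n}. k < l \<longrightarrow> \<phi> l < \<phi> k)"

text \<open>
  Since \<open>[1]\<close> is only an equivalence, the equality \<open>P (\<phi> + 1) = (P \<phi>)[1]\<close> of full subcategories is
  read up to isomorphism of objects: both sides have the same closure under isomorphisms.  For
  subcategories closed under isomorphisms this says that \<open>P (\<phi> + 1)\<close> is the essential image of
  \<open>P \<phi>\<close> under \<open>[1]\<close>.
\<close>

definition slicing :: "('o, 'm) tri_cat \<Rightarrow> 'o slicing \<Rightarrow> bool" where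
  "slicing D P \<longleftrightarrow>
     (\<forall>\<phi>. P \<phi> \<subseteq> Ob D) \<and>
     (\<forall>\<phi>. iso_closure D (P (\<phi> + 1)) = iso_closure D (Sh D ` P \<phi>)) \<and>
     (\<forall>\<phi> \<psi>. \<psi> < \<phi> \<longrightarrow> (\<forall>A \<in> P \<phi>. \<forall>B \<in> P \<psi>. Mor D A B = {Zero_mor D A B})) \<and>
     (\<forall>X \<in> Ob D. \<not> zero_object D X \<longrightarrow> (\<exists>n E f A \<phi>. HN_filtration D P X n E f A \<phi>))"

text \<open>
  Harder-Narasimhan phases do not depend on the filtration, hence the definite descriptions; they
  are used for nonzero objects only, where \<open>n \<ge> 1\<close>.
\<close>

definition phase_plus :: "('o, 'm) tri_cat \<Rightarrow> 'o slicing \<Rightarrow> 'o \<Rightarrow> real" where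
  "phase_plus D P X = (THE t. \<exists>n E f A \<phi>. HN_filtration D P X n E f A \<phi> \<and> t = \<phi> 1)"

definition phase_minus :: "('o, 'm) tri_cat \<Rightarrow> 'o slicing \<Rightarrow> 'o \<Rightarrow> real" where
  "phase_minus D P X = (THE t. \<exists>n E f A \<phi>. HN_filtration D P X n E f A \<phi> \<and> t = \<phi> n)"

definition slicing_dist :: "('o, 'm) tri_cat \<Rightarrow> 'o slicing \<Rightarrow> 'o slicing \<Rightarrow> ennreal" where
  "slicing_dist D P R = (SUP X \<in> {X \<in> Ob D. \<not> zero_object D X}.
     ennreal (max \<bar>phase_plus D P X - phase_plus D R X\<bar> \<bar>phase_minus D P X - phase_minus D R X\<bar>))"

section \<open>Stability conditions\<close>

type_synonym ('o, 'g) stab = "('g \<Rightarrow> complex) \<times> 'o slicing"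

definition semistable :: "('o, 'm) tri_cat \<Rightarrow> ('o, 'g) stab \<Rightarrow> 'o \<Rightarrow> bool" where
  "semistable D \<sigma> E \<longleftrightarrow> \<not> zero_object D E \<and> (\<exists>\<phi>. E \<in> snd \<sigma> \<phi>)"

definition stability_condition ::
  "('o, 'm) tri_cat \<Rightarrow> (('o \<Rightarrow>\<^sub>0 int) set \<Rightarrow> 'g::ab_group_add) \<Rightarrow> ('g realification \<Rightarrow> real) \<Rightarrow>
   ('o, 'g) stab \<Rightarrow> bool" where
  "stability_condition D cl N \<sigma> \<longleftrightarrow>
     (case \<sigma> of (Z, P) \<Rightarrow>
       Modules.additive Z \<and> slicing D P \<and>
       (\<forall>\<phi>. \<forall>E \<in> P \<phi>. \<not> zero_object D E \<longrightarrow>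
          (\<exists>r>0. Z (cl (K_class D E)) = of_real r * exp (\<i> * of_real (pi * \<phi>)))) \<and>
       (\<exists>\<epsilon>>0. \<forall>E. semistable D (Z, P) E \<longrightarrow>
          cmod (Z (cl (K_class D E))) \<ge> \<epsilon> * N (lattice_incl (cl (K_class D E)))))"

text \<open>
  \<open>Hom(\<Gamma>, \<complex>)\<close> carries the topology of pointwise convergence, i.e. the subspace topology of the
  product topology on functions \<open>\<Gamma> \<rightarrow> \<complex>\<close>; for \<open>\<Gamma>\<close> of finite rank this is the usual topology of
  the finite-dimensional complex vector space \<open>Hom(\<Gamma>, \<complex>)\<close>.
\<close>

definition continuous_stab_family ::
  "('o, 'm) tri_cat \<Rightarrow> 'x topology \<Rightarrow> ('x \<Rightarrow> ('o, 'g) stab) \<Rightarrow> bool" where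
  "continuous_stab_family D M \<sigma> \<longleftrightarrow>
     continuous_map M euclidean (\<lambda>x. fst (\<sigma> x)) \<and>
     (\<forall>x \<in> topspace M. \<forall>\<epsilon>>0. \<exists>U. openin M U \<and> x \<in> U \<and>
        (\<forall>y \<in> U. slicing_dist D (snd (\<sigma> x)) (snd (\<sigma> y)) < ennreal \<epsilon>))"

end

theory Submission
  imports Defs
begin

text \<open>
  Along a path in \<open>M\<close> it suffices to show that nonnegativity of \<open>Q\<close> on semistable classes is a locally
  constant condition.  Near \<open>t\<^sub>0\<close> all the slicings are close to each other, so the Harder--Narasimhan
  factors at time \<open>s\<close> of an object semistable at time \<open>t\<close> have central charges \<open>Z t\<^sub>0\<close> in a common sector
  of angle \<open>\<pi>/2\<close>.  Passing to such factors therefore decreases \<open>|Z t\<^sub>0|\<^sup>2\<close>, and by the support property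
  and discreteness of \<open>\<Gamma>\<close> it does so by a fixed amount; this allows an induction.  For a
  counterexample \<open>F\<close> with minimal \<open>|Z t\<^sub>0|\<^sup>2\<close> the set of times at which \<open>F\<close> is semistable is closed, as
  the phases vary continuously.  It is also open: if \<open>F\<close> were unstable at times \<open>s\<close> arbitrarily close
  to \<open>s\<^sub>0\<close>, its factors would have \<open>Q \<ge> 0\<close> and almost aligned values of \<open>Z s\<^sub>0\<close>, and since \<open>Q\<close> is negative
  semi-definite on \<open>Ker Z s\<^sub>0\<close> this forces \<open>Q(F) \<ge> 0\<close> in the limit.  So \<open>F\<close> is semistable throughout the
  neighbourhood.

  Since \<open>P\<^sub>\<phi>\<close> need not be closed under isomorphism, ``semistable'' is expressed throughout
  by the equality of the phases \<open>\<phi>\<^sup>+ = \<phi>\<^sup>-\<close>.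
\<close>

section \<open>Harder--Narasimhan filtrations\<close>

definition hom_zero :: "('o, 'm) tri_cat \<Rightarrow> 'o \<Rightarrow> 'o \<Rightarrow> bool" where
  "hom_zero D X Y \<longleftrightarrow> Mor D X Y = {Zero_mor D X Y}"

context triangulated_category
begin

section \<open>Zero morphisms and zero objects\<close>

lemma Zero_in: "X \<in> Ob D \<Longrightarrow> Y \<in> Ob D \<Longrightarrow> Zero_mor D X Y \<in> Mor D X Y"
  using group.is_monoid[OF comm_group.axioms(2)[OF hom_group[of X Y]], THEN monoid.one_closed]
  by (simp add: hom_group_def)

lemma hom_zeroI:
  assumes "X \<in> Ob D" "Y \<in> Ob D" "\<And>f. f \<in> Mor D X Y \<Longrightarrow> f = Zero_mor D X Y"
  shows "hom_zero D X Y"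
  unfolding hom_zero_def using assms Zero_in by blast

text \<open>A group has only one element with f + f = f. Additive maps preserve this equation, which
  is how composites and shifts of zero morphisms are recognised below.\<close>

lemma zero_of_double:
  assumes "X \<in> Ob D" "Y \<in> Ob D" "f \<in> Mor D X Y" "Add D f f = f"
  shows "f = Zero_mor D X Y"
proof -
  interpret comm_group "hom_group D X Y" using assms by (intro hom_group)
  show ?thesis using assms(3,4) l_cancel_one'[of f f] by (simp add: hom_group_def)
qed

lemma Add_Zero: "X \<in> Ob D \<Longrightarrow> Y \<in> Ob D \<Longrightarrow> Add D (Zero_mor D X Y) (Zero_mor D X Y) = Zero_mor D X Y"
proof -
  assume "X \<in> Ob D" "Y \<in> Ob D"
  then interpret comm_group "hom_group D X Y" by (intro hom_group)
  show ?thesis using l_one[OF one_closed] by (simp add: hom_group_def)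
qed

lemma Zero_Cmp:
  assumes "X \<in> Ob D" "Y \<in> Ob D" "Z \<in> Ob D" "f \<in> Mor D X Y"
  shows "Zero_mor D Y Z \<cdot> f = Zero_mor D X Z"
proof (rule zero_of_double)
  show "Add D (Zero_mor D Y Z \<cdot> f) (Zero_mor D Y Z \<cdot> f) = Zero_mor D Y Z \<cdot> f"
    using Cmp_Add_left[OF assms(1-4) Zero_in Zero_in] assms by (simp add: Add_Zero)
qed (use assms Cmp_in Zero_in in blast)+

lemma Cmp_Zero:
  assumes "X \<in> Ob D" "Y \<in> Ob D" "Z \<in> Ob D" "g \<in> Mor D Y Z"
  shows "g \<cdot> Zero_mor D X Y = Zero_mor D X Z"
proof (rule zero_of_double)
  show "Add D (g \<cdot> Zero_mor D X Y) (g \<cdot> Zero_mor D X Y) = g \<cdot> Zero_mor D X Y"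
    using Cmp_Add_right[OF assms(1-3) Zero_in Zero_in assms(4)] assms by (simp add: Add_Zero)
qed (use assms Cmp_in Zero_in in blast)+

lemma Sh_Zero:
  assumes "X \<in> Ob D" "Y \<in> Ob D"
  shows "Sh_mor D (Zero_mor D X Y) = Zero_mor D (Sh D X) (Sh D Y)"
proof (rule zero_of_double)
  show "Sh_mor D (Zero_mor D X Y) \<in> Mor D (Sh D X) (Sh D Y)"
    using Sh_mor_bij[OF assms] Zero_in[OF assms] by (auto simp: bij_betw_def)
  show "Add D (Sh_mor D (Zero_mor D X Y)) (Sh_mor D (Zero_mor D X Y)) = Sh_mor D (Zero_mor D X Y)"
    using Sh_Add[OF assms Zero_in[OF assms] Zero_in[OF assms]] by (simp add: Add_Zero assms)
qed (use assms Sh_in in auto)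

lemma hom_zero_Sh:
  assumes "X \<in> Ob D" "Y \<in> Ob D"
  shows "hom_zero D (Sh D X) (Sh D Y) \<longleftrightarrow> hom_zero D X Y"
proof -
  have "Sh_mor D ` Mor D X Y = Mor D (Sh D X) (Sh D Y)" "inj_on (Sh_mor D) (Mor D X Y)"
    using Sh_mor_bij[OF assms] by (auto simp: bij_betw_def)
  moreover have "Sh_mor D ` {Zero_mor D X Y} = {Zero_mor D (Sh D X) (Sh D Y)}"
    by (simp add: Sh_Zero assms)
  ultimately show ?thesis
    unfolding hom_zero_def using Zero_in[OF assms] by (metis empty_subsetI inj_on_image_eq_iff insert_subset subset_refl)
qed

text \<open>If Hom(X, X) vanishes, the identity of \<open>X\<close> is zero, and every morphism into
  or out of \<open>X\<close> factors through it.\<close>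

lemma zero_object_iff: "zero_object D X \<longleftrightarrow> X \<in> Ob D \<and> hom_zero D X X"
proof
  assume "zero_object D X"
  then show "X \<in> Ob D \<and> hom_zero D X X"
    using Zero_in[of X X] by (auto simp: zero_object_def intro!: hom_zeroI)
next
  assume X: "X \<in> Ob D \<and> hom_zero D X X"
  then have id: "Idt D X = Zero_mor D X X"
    using Idt_in by (auto simp: hom_zero_def)
  show "zero_object D X"
    unfolding zero_object_def
  proof (intro conjI ballI)
    fix Y assume Y: "Y \<in> Ob D"
    have "f = Zero_mor D X Y" if "f \<in> Mor D X Y" for f
      using Cmp_Idt[of X Y f] Cmp_Zero[of X X Y f] X Y that by (simp add: id)
    then show "\<exists>!f. f \<in> Mor D X Y" using Zero_in X Y by blast
    have "f = Zero_mor D Y X" if "f \<in> Mor D Y X" for f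
      using Idt_Cmp[of Y X f] Zero_Cmp[of Y X X f] X Y that by (simp add: id)
    then show "\<exists>!f. f \<in> Mor D Y X" using Zero_in X Y by blast
  qed (use X in auto)
qed

lemma zero_object_hom_zero:
  assumes "zero_object D X" "Y \<in> Ob D"
  shows "hom_zero D X Y" "hom_zero D Y X"
  using assms Zero_in by (auto simp: zero_object_def intro!: hom_zeroI)

lemma zero_object_Sh: "zero_object D X \<Longrightarrow> zero_object D (Sh D X)"
  using hom_zero_Sh Sh_in by (auto simp: zero_object_iff)

section \<open>Distinguished triangles and vanishing of Hom\<close>

lemma inv_in:
  assumes "X \<in> Ob D" "Y \<in> Ob D" "f \<in> Mor D X Y"
  shows "inv\<^bsub>hom_group D X Y\<^esub> f \<in> Mor D X Y"
proof -
  interpret comm_group "hom_group D X Y" using assms by (intro hom_group)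
  show ?thesis using inv_closed[of f] assms(3) by (simp add: hom_group_def)
qed

lemma inv_Zero:
  assumes "X \<in> Ob D" "Y \<in> Ob D"
  shows "inv\<^bsub>hom_group D X Y\<^esub> (Zero_mor D X Y) = Zero_mor D X Y"
proof -
  interpret comm_group "hom_group D X Y" using assms by (intro hom_group)
  show ?thesis using inv_one by (simp add: hom_group_def)
qed

lemma Sh_mor_in: "\<lbrakk>X \<in> Ob D; Y \<in> Ob D; f \<in> Mor D X Y\<rbrakk> \<Longrightarrow> Sh_mor D f \<in> Mor D (Sh D X) (Sh D Y)"
  using Sh_mor_bij[of X Y] by (auto simp: bij_betw_def)

lemma Dist_rotate:
  "Dist D X Y Z f g h \<Longrightarrow> Dist D Y Z (Sh D X) g h (inv\<^bsub>hom_group D (Sh D X) (Sh D Y)\<^esub> (Sh_mor D f))"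
  using TR2 Dist_in by blast

lemma Dist_zero_left:
  assumes "X \<in> Ob D" "zero_object D N"
  shows "\<exists>h. Dist D N X X (Zero_mor D N X) (Idt D X) h"
proof -
  have N: "N \<in> Ob D" using assms(2) by (simp add: zero_object_def)
  have SN: "zero_object D (Sh D N)" using zero_object_Sh[OF assms(2)] .
  have "Dist D X X (Sh D N) (Idt D X) (Zero_mor D X (Sh D N)) (Zero_mor D (Sh D N) (Sh D X))"
    using TR1_Idt[OF assms(1) SN] .
  \<comment> \<open>TR2 is read backwards from a triangle ending in N[1]; the sign in the rotation
    is harmless because the morphism N -> X is zero.\<close>
  then have "Dist D N X X (Zero_mor D N X) (Idt D X) (Zero_mor D X (Sh D N))"
    by (subst TR2) (use N assms SN Sh_in Zero_in Idt_in in \<open>auto simp: Sh_Zero inv_Zero\<close>)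
  then show ?thesis by blast
qed

text \<open>Part of the long exact Hom sequence: a morphism from \<open>Y\<close> to
  \<open>B\<close> that becomes zero after composition with \<open>f\<close> extends by TR3 to a
  morphism of triangles into N -> B -> B, hence factors through \<open>Z\<close>.\<close>

lemma hom_zero_mid_left:
  assumes "Dist D X Y Z f g h" "B \<in> Ob D" "hom_zero D X B" "hom_zero D Z B"
  shows "hom_zero D Y B"
proof (rule hom_zeroI)
  note Dist = Dist_in[OF assms(1)]
  obtain N where N: "zero_object D N" using zero_object_exists by blast
  then have N_Ob: "N \<in> Ob D" by (simp add: zero_object_def)
  obtain h' where h': "Dist D N B B (Zero_mor D N B) (Idt D B) h'"
    using Dist_zero_left[OF assms(2) N] by blast
  fix u assume u: "u \<in> Mor D Y B"
  have "u \<cdot> f \<in> Mor D X B" using Cmp_in[of X Y B f u] Dist u assms(2) by blast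
  then have "u \<cdot> f = Zero_mor D N B \<cdot> Zero_mor D X N"
    using assms(3) Zero_Cmp[of X N B] Zero_in[of X N] Dist N_Ob assms(2) by (simp add: hom_zero_def)
  then obtain c where c: "c \<in> Mor D Z B" "c \<cdot> g = Idt D B \<cdot> u"
    using TR3[OF assms(1) h' _ u, of "Zero_mor D X N"] Zero_in[of X N] Dist N_Ob by blast
  then have "u = Zero_mor D Z B \<cdot> g"
    using assms(4) Idt_Cmp[of Y B u] u Dist assms(2) by (simp add: hom_zero_def)
  then show "u = Zero_mor D Y B" using Zero_Cmp[of Y Z B g] Dist assms(2) by simp
qed (use assms Dist_in[OF assms(1)] in auto)

text \<open>The covariant counterpart. TR3 supplies only the third morphism, so it is applied to the
  rotated triangles B -> N -> B[1] and Y -> Z -> X[1]; then u[1] factors through X[1] up to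
  sign.\<close>

lemma hom_zero_mid_right:
  assumes "Dist D X Y Z f g h" "B \<in> Ob D" "hom_zero D B X" "hom_zero D B Z"
  shows "hom_zero D B Y"
proof (rule hom_zeroI)
  note Dist = Dist_in[OF assms(1)]
  obtain N where N: "zero_object D N" using zero_object_exists by blast
  then have N_Ob: "N \<in> Ob D" by (simp add: zero_object_def)
  note B = assms(2)
  have Tri: "Dist D B N (Sh D B) (Zero_mor D B N) (Zero_mor D N (Sh D B))
      (inv\<^bsub>hom_group D (Sh D B) (Sh D B)\<^esub> (Sh_mor D (Idt D B)))" (is "Dist D _ _ _ _ _ ?m")
    using Dist_rotate[OF TR1_Idt[OF B N]] .
  have SB: "Sh D B \<in> Ob D" "Sh D Y \<in> Ob D" "Sh D X \<in> Ob D" using Sh_in B Dist by auto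
  have m: "?m \<in> Mor D (Sh D B) (Sh D B)"
    using inv_in[OF SB(1,1)] Sh_mor_in[OF B B Idt_in[OF B]] by blast
  fix u assume u: "u \<in> Mor D B Y"
  then have Su: "Sh_mor D u \<in> Mor D (Sh D B) (Sh D Y)" using Sh_mor_in[of B Y] B Dist by blast
  have "g \<cdot> u \<in> Mor D B Z" using Cmp_in[of B Y Z u g] Dist u B by blast
  then have "Zero_mor D N Z \<cdot> Zero_mor D B N = g \<cdot> u"
    using assms(4) Zero_Cmp[of B N Z] Zero_in[of B N] Dist N_Ob B by (simp add: hom_zero_def)
  then obtain c where c: "c \<in> Mor D (Sh D B) (Sh D X)"
    "Sh_mor D u \<cdot> ?m = inv\<^bsub>hom_group D (Sh D X) (Sh D Y)\<^esub> (Sh_mor D f) \<cdot> c"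
    using TR3[OF Tri Dist_rotate[OF assms(1)] u, of "Zero_mor D N Z"] Zero_in[of N Z] Dist N_Ob by blast
  have "c = Zero_mor D (Sh D B) (Sh D X)"
    using c(1) assms(3) hom_zero_Sh[of B X] B Dist by (auto simp: hom_zero_def)
  then have eq: "Sh_mor D u \<cdot> ?m = Zero_mor D (Sh D B) (Sh D Y)"
    using c(2) Cmp_Zero[of "Sh D B" "Sh D X" "Sh D Y"] SB inv_in Sh_mor_in[of X Y] Dist by auto
  \<comment> \<open>\<open>?m\<close> is minus the identity of B[1]; additivity of composition then
    turns the vanishing of u[1] composed with \<open>?m\<close> into that of u[1].\<close>
  have "Add D ?m (Idt D (Sh D B)) = Zero_mor D (Sh D B) (Sh D B)"
  proof -
    interpret comm_group "hom_group D (Sh D B) (Sh D B)" using SB by (intro hom_group)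
    show ?thesis using l_inv[of "Idt D (Sh D B)"] Idt_in[OF SB(1)]
      by (simp add: hom_group_def Sh_Idt[OF B])
  qed
  then have "Sh_mor D u \<cdot> Zero_mor D (Sh D B) (Sh D B) = Add D (Zero_mor D (Sh D B) (Sh D Y)) (Sh_mor D u)"
    using Cmp_Add_right[OF SB(1,1,2) m Idt_in[OF SB(1)] Su] eq Cmp_Idt[OF SB(1,2) Su] by simp
  then have "Sh_mor D u = Zero_mor D (Sh D B) (Sh D Y)"
  proof -
    assume *: "Sh_mor D u \<cdot> Zero_mor D (Sh D B) (Sh D B) = Add D (Zero_mor D (Sh D B) (Sh D Y)) (Sh_mor D u)"
    interpret comm_group "hom_group D (Sh D B) (Sh D Y)" using SB by (intro hom_group)
    show ?thesis using * l_one[of "Sh_mor D u"] Su Cmp_Zero[OF SB(1,1,2) Su] by (simp add: hom_group_def)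
  qed
  then have "Sh_mor D u = Sh_mor D (Zero_mor D B Y)" using Sh_Zero[of B Y] B Dist by simp
  then show "u = Zero_mor D B Y"
    using Sh_mor_bij[of B Y] u Zero_in[of B Y] B Dist by (auto simp: bij_betw_def inj_on_def)
qed (use assms Dist_in[OF assms(1)] in auto)

text \<open>Three rotations give the shifted triangle; the signs they introduce are absorbed by the
  existential quantifiers.\<close>

lemma Dist_Sh: "Dist D X Y Z f g h \<Longrightarrow> \<exists>f g h. Dist D (Sh D X) (Sh D Y) (Sh D Z) f g h"
  using Dist_rotate by blast

lemma iso_hom_zero_left:
  assumes "iso_mor D X Y f" "X \<in> Ob D" "Y \<in> Ob D" "B \<in> Ob D" "hom_zero D Y B"
  shows "hom_zero D X B"
proof (rule hom_zeroI)
  obtain g where g: "f \<in> Mor D X Y" "g \<in> Mor D Y X" "g \<cdot> f = Idt D X"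
    using assms(1) by (auto simp: iso_mor_def)
  fix u assume u: "u \<in> Mor D X B"
  have "u = u \<cdot> (g \<cdot> f)" using Cmp_Idt u assms g by simp
  also have "\<dots> = (u \<cdot> g) \<cdot> f" using Cmp_assoc[of X Y X B f g u] g u assms by blast
  also have "u \<cdot> g = Zero_mor D Y B" using Cmp_in[of Y X B g u] g u assms by (auto simp: hom_zero_def)
  finally show "u = Zero_mor D X B" using Zero_Cmp[of X Y B f] g assms by simp
qed (use assms in auto)

text \<open>Rotation places \<open>Z\<close> between \<open>Y\<close> and X[1]. Both are zero, so
  the identity of \<open>Z\<close> vanishes.\<close>

lemma zero_object_cone:
  assumes "Dist D X Y Z f g h" "zero_object D X" "zero_object D Y"
  shows "zero_object D Z"
proof -
  note Dist = Dist_in[OF assms(1)]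
  have "hom_zero D Z Z"
    using hom_zero_mid_left[OF Dist_rotate[OF assms(1)]] Dist assms(2,3)
      zero_object_hom_zero zero_object_Sh by blast
  then show ?thesis using Dist by (simp add: zero_object_iff)
qed

section \<open>Slicings and uniqueness of the extreme phases\<close>

lemma slicing_Ob: "slicing D P \<Longrightarrow> A \<in> P \<phi> \<Longrightarrow> A \<in> Ob D"
  by (auto simp: slicing_def)

lemma slicing_hom_zero:
  "slicing D P \<Longrightarrow> A \<in> P \<phi> \<Longrightarrow> B \<in> P \<psi> \<Longrightarrow> \<psi> < \<phi> \<Longrightarrow> hom_zero D A B"
  by (auto simp: slicing_def hom_zero_def)

text \<open>\<open>slicing\<close> compares P(\<phi> + 1) with P(\<phi>)[1] only up to isomorphism,
  so A[1] is first replaced by an isomorphic object of phase \<phi> + 1.\<close>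

lemma slicing_hom_zero_Sh:
  assumes "slicing D P" "A \<in> P \<phi>" "B \<in> P \<psi>" "\<psi> < \<phi> + 1"
  shows "hom_zero D (Sh D A) B"
proof -
  have A: "A \<in> Ob D" and B: "B \<in> Ob D" using assms slicing_Ob by blast+
  then have SA: "Sh D A \<in> Ob D" by (simp add: Sh_in)
  have "iso_mor D (Sh D A) (Sh D A) (Idt D (Sh D A))"
    using Idt_in[OF SA] Cmp_Idt[OF SA SA Idt_in[OF SA]] by (auto simp: iso_mor_def)
  then have "Sh D A \<in> iso_closure D (Sh D ` P \<phi>)"
    using SA assms(2) by (auto simp: iso_closure_def)
  then have "Sh D A \<in> iso_closure D (P (\<phi> + 1))"
    using assms(1) by (simp add: slicing_def)
  then obtain A' f where A': "A' \<in> P (\<phi> + 1)" "iso_mor D A' (Sh D A) f"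
    by (auto simp: iso_closure_def)
  then obtain g where "iso_mor D (Sh D A) A' g"
    unfolding iso_mor_def by blast
  then show ?thesis
    using iso_hom_zero_left slicing_hom_zero[OF assms(1) A'(1) assms(3,4)] SA B A'(1)
      slicing_Ob[OF assms(1)] by blast
qed

text \<open>Induction along the filtration: in each triangle the middle term inherits the vanishing
  from its two neighbours.\<close>

lemma hom_zero_filtration_left:
  fixes n :: nat
  assumes "zero_object D (E 0)" "B \<in> Ob D"
    and "\<And>k. k \<in> {1..n} \<Longrightarrow> \<exists>f g h. Dist D (E (k - 1)) (E k) (A k) f g h"
    and "\<And>k. k \<in> {1..n} \<Longrightarrow> hom_zero D (A k) B"
  shows "hom_zero D (E n) B"
  using assms(3,4)
proof (induction n)
  case 0
  then show ?case using zero_object_hom_zero assms(1,2) by blast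
next
  case (Suc n)
  then have "hom_zero D (E n) B" by simp
  then show ?case using hom_zero_mid_left Suc.prems[of "Suc n"] assms(2) by fastforce
qed

lemma hom_zero_filtration_right:
  fixes n :: nat
  assumes "zero_object D (E 0)" "B \<in> Ob D"
    and "\<And>k. k \<in> {1..n} \<Longrightarrow> \<exists>f g h. Dist D (E (k - 1)) (E k) (A k) f g h"
    and "\<And>k. k \<in> {1..n} \<Longrightarrow> hom_zero D B (A k)"
  shows "hom_zero D B (E n)"
  using assms(3,4)
proof (induction n)
  case 0
  then show ?case using zero_object_hom_zero assms(1,2) by blast
next
  case (Suc n)
  then have "hom_zero D B (E n)" by simp
  then show ?case using hom_zero_mid_right Suc.prems[of "Suc n"] assms(2) by fastforce
qed

lemma HN_filtrationD:
  assumes "HN_filtration D P X n E f A \<phi>"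
  shows "zero_object D (E 0)" "E n = X"
    and "\<And>k. k \<in> {1..n} \<Longrightarrow> \<exists>f g h. Dist D (E (k - 1)) (E k) (A k) f g h"
    and "\<And>k. k \<in> {1..n} \<Longrightarrow> A k \<in> P (\<phi> k)"
    and "\<And>k. k \<in> {1..n} \<Longrightarrow> \<not> zero_object D (A k)"
    and "\<And>k l. k \<in> {1..n} \<Longrightarrow> l \<in> {1..n} \<Longrightarrow> k < l \<Longrightarrow> \<phi> l < \<phi> k"
    and "\<And>k l. k \<in> {1..n} \<Longrightarrow> l \<in> {1..n} \<Longrightarrow> k \<le> l \<Longrightarrow> \<phi> l \<le> \<phi> k"
proof -
  note H = assms[unfolded HN_filtration_def]
  show "zero_object D (E 0)" "E n = X" using H by auto
  show "\<exists>f g h. Dist D (E (k - 1)) (E k) (A k) f g h" "A k \<in> P (\<phi> k)" "\<not> zero_object D (A k)"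
    if "k \<in> {1..n}" for k
    using H that by blast+
  show less: "\<phi> l < \<phi> k" if "k \<in> {1..n}" "l \<in> {1..n}" "k < l" for k l
    using H that by blast
  show "\<phi> l \<le> \<phi> k" if "k \<in> {1..n}" "l \<in> {1..n}" "k \<le> l" for k l
    using less[of k l] that by (cases "k = l") auto
qed

lemma HN_length_pos:
  assumes "HN_filtration D P X n E f A \<phi>" "\<not> zero_object D X"
  shows "1 \<le> n"
  using HN_filtrationD(1,2)[OF assms(1)] assms(2) by (cases n) auto

lemma HN_Ob:
  assumes "HN_filtration D P X n E f A \<phi>" "k \<le> n"
  shows "E k \<in> Ob D"
proof (cases "k = 0")
  case True
  then show ?thesis using HN_filtrationD(1)[OF assms(1)] by (simp add: zero_object_def)
next
  case False
  then show ?thesis using HN_filtrationD(3)[OF assms(1), of k] assms(2) Dist_in by fastforce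
qed

text \<open>Shifting the filtration termwise presents (E m)[1] by the cones (A k)[1], which are of
  phase \<phi> k + 1 up to isomorphism. The phase comparisons need this for the shifted terms of
  rotated triangles.\<close>

lemma hom_zero_filtration_Sh:
  assumes "slicing D P" "HN_filtration D P X n E f A \<phi>" "m \<le> n" "B \<in> P \<psi>"
    and "\<And>k. k \<in> {1..m} \<Longrightarrow> \<psi> < \<phi> k + 1"
  shows "hom_zero D (Sh D (E m)) B"
proof (rule hom_zero_filtration_left[of "\<lambda>k. Sh D (E k)" _ m "\<lambda>k. Sh D (A k)"])
  note H = HN_filtrationD[OF assms(2)]
  show "zero_object D (Sh D (E 0))" using H(1) zero_object_Sh by blast
  show "B \<in> Ob D" using slicing_Ob assms(1,4) by blast
  fix k assume k: "k \<in> {1..m}"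
  then show "\<exists>f g h. Dist D (Sh D (E (k - 1))) (Sh D (E k)) (Sh D (A k)) f g h"
    using H(3)[of k] Dist_Sh assms(3) by fastforce
  show "hom_zero D (Sh D (A k)) B"
    using slicing_hom_zero_Sh[OF assms(1) H(4) assms(4), of k] assms(3,5) k by auto
qed

text \<open>
  If \<open>\<phi> 1 < \<phi>' 1\<close> then there are no nonzero maps \<open>E' 1 \<rightarrow> E' n' = X\<close>.  Going down the second
  filtration, this vanishing lifts to \<open>E' 1 \<rightarrow> E' k\<close> for all \<open>k\<close>, hence to the identity of \<open>E' 1\<close>.
\<close>

lemma HN_phase_plus_le:
  assumes P: "slicing D P" and X: "\<not> zero_object D X"
    and 1: "HN_filtration D P X n E f A \<phi>" and 2: "HN_filtration D P X n' E' f' A' \<phi>'"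
  shows "\<phi>' 1 \<le> \<phi> 1"
proof (rule ccontr)
  assume "\<not> \<phi>' 1 \<le> \<phi> 1"
  then have less: "\<phi> 1 < \<phi>' 1" by simp
  note H = HN_filtrationD[OF 1] and H' = HN_filtrationD[OF 2]
  have n: "1 \<le> n" "1 \<le> n'" using HN_length_pos X 1 2 by blast+
  have E1: "E' 1 \<in> Ob D" using HN_Ob[OF 2] n by blast
  have "hom_zero D (E' 1) (A k)" if k: "k \<in> {1..n}" for k
  proof (rule hom_zero_filtration_left[of E' _ 1 A'])
    show "A k \<in> Ob D" using slicing_Ob[OF P] H(4)[OF k] by blast
    have "\<phi> k \<le> \<phi> 1" using H(7)[of 1 k] k by auto
    then show "hom_zero D (A' l) (A k)" if "l \<in> {1..1}" for l
      using slicing_hom_zero[OF P H'(4) H(4)[OF k], of l] that n less by auto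
    show "\<exists>f g h. Dist D (E' (l - 1)) (E' l) (A' l) f g h" if "l \<in> {1..1}" for l
      using H'(3)[of l] that n by simp
  qed (rule H'(1))
  then have "hom_zero D (E' 1) (E n)"
    by (intro hom_zero_filtration_right[of E _ n A] H(1,3) E1)
  then have last: "hom_zero D (E' 1) (E' n')" by (simp add: H(2) H'(2))
  have "hom_zero D (E' 1) (E' 1)"
  proof (rule inc_induct[where P = "\<lambda>k. hom_zero D (E' 1) (E' k)", OF n(2) last])
    fix k assume step: "1 \<le> k" "k < n'" "hom_zero D (E' 1) (E' (Suc k))"
    then have k: "Suc k \<in> {1..n'}" by simp
    have Ek: "E' k \<in> Ob D" "E' (Suc k) \<in> Ob D" using HN_Ob[OF 2] step by simp_all
    obtain f g h where "Dist D (E' k) (E' (Suc k)) (A' (Suc k)) f g h"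
      using H'(3)[OF k] by auto
    \<comment> \<open>Two rotations place (E' k)[1] between A' (k + 1) and (E' (k + 1))[1]. The
      former receives no nonzero maps from (E' 1)[1], whose phase \<phi>' 1 + 1 is larger.\<close>
    then obtain f g h where "Dist D (A' (Suc k)) (Sh D (E' k)) (Sh D (E' (Suc k))) f g h"
      using Dist_rotate by blast
    moreover have "hom_zero D (Sh D (E' 1)) (A' (Suc k))"
      using H'(7)[of 1 "Suc k"] k n
      by (intro hom_zero_filtration_Sh[OF P 2 _ H'(4)[OF k]]) auto
    moreover have "hom_zero D (Sh D (E' 1)) (Sh D (E' (Suc k)))"
      using hom_zero_Sh E1 Ek step by blast
    ultimately have "hom_zero D (Sh D (E' 1)) (Sh D (E' k))"
      using hom_zero_mid_right Sh_in E1 by blast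
    then show "hom_zero D (E' 1) (E' k)" using hom_zero_Sh E1 Ek by blast
  qed
  then have "zero_object D (E' 1)" using E1 by (simp add: zero_object_iff)
  then have "zero_object D (A' 1)" using zero_object_cone H'(1) H'(3)[of 1] n by fastforce
  then show False using H'(5)[of 1] n by simp
qed

text \<open>If \<phi>' n' < \<phi> n, neither \<open>X\<close> nor (E' (n' - 1))[1] has nonzero maps
  to A' n'. The last triangle of the second filtration, once rotated, places A' n' between these
  two, so its identity would vanish.\<close>

lemma HN_phase_minus_ge:
  assumes P: "slicing D P" and X: "\<not> zero_object D X"
    and 1: "HN_filtration D P X n E f A \<phi>" and 2: "HN_filtration D P X n' E' f' A' \<phi>'"
  shows "\<phi> n \<le> \<phi>' n'"
proof (rule ccontr)
  assume "\<not> \<phi> n \<le> \<phi>' n'"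
  then have less: "\<phi>' n' < \<phi> n" by simp
  note H = HN_filtrationD[OF 1] and H' = HN_filtrationD[OF 2]
  have n: "1 \<le> n" "1 \<le> n'" using HN_length_pos X 1 2 by blast+
  have n': "n' \<in> {1..n'}" using n by simp
  have A': "A' n' \<in> Ob D" using slicing_Ob[OF P] H'(4)[OF n'] by blast
  have "hom_zero D (E n) (A' n')"
  proof (rule hom_zero_filtration_left[of E _ n A])
    fix k assume k: "k \<in> {1..n}"
    have "\<phi> n \<le> \<phi> k" using H(7)[of k n] k by auto
    then show "hom_zero D (A k) (A' n')"
      using slicing_hom_zero[OF P H(4)[OF k] H'(4)[OF n']] less by simp
  qed (use H(1,3) A' in auto)
  then have "hom_zero D (E' n') (A' n')" by (simp add: H(2) H'(2))
  moreover have "hom_zero D (Sh D (E' (n' - 1))) (A' n')"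
  proof (rule hom_zero_filtration_Sh[OF P 2 _ H'(4)[OF n']])
    fix k assume "k \<in> {1..n' - 1}"
    then show "\<phi>' n' < \<phi>' k + 1" using H'(7)[of k n'] by force
  qed simp
  moreover obtain f g h where "Dist D (E' n') (A' n') (Sh D (E' (n' - 1))) f g h"
    using H'(3)[OF n'] Dist_rotate by blast
  ultimately have "hom_zero D (A' n') (A' n')"
    using hom_zero_mid_left A' by blast
  then show False using H'(5)[OF n'] A' by (simp add: zero_object_iff)
qed

text \<open>Comparing two filtrations in both orders shows that the first phase is unique, which
  justifies the definite description.\<close>

lemma phase_plus_HN:
  assumes "slicing D P" "\<not> zero_object D X" "HN_filtration D P X n E f A \<phi>"
  shows "phase_plus D P X = \<phi> 1"
  unfolding phase_plus_def
proof (rule the_equality)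
  show "\<exists>n' E f A \<phi>'. HN_filtration D P X n' E f A \<phi>' \<and> \<phi> 1 = \<phi>' 1"
    using assms(3) by blast
  show "t = \<phi> 1" if ex: "\<exists>n E f A \<phi>. HN_filtration D P X n E f A \<phi> \<and> t = \<phi> 1" for t
  proof -
    obtain n' E' f' A' \<phi>' where "HN_filtration D P X n' E' f' A' \<phi>'" "t = \<phi>' 1"
      using ex by blast
    then show ?thesis
      using HN_phase_plus_le[OF assms(1,2) assms(3)] HN_phase_plus_le[OF assms(1,2) _ assms(3)]
      by (metis order_antisym)
  qed
qed

lemma phase_minus_HN:
  assumes "slicing D P" "\<not> zero_object D X" "HN_filtration D P X n E f A \<phi>"
  shows "phase_minus D P X = \<phi> n"
  unfolding phase_minus_def
proof (rule the_equality)
  show "\<exists>n' E f A \<phi>'. HN_filtration D P X n' E f A \<phi>' \<and> \<phi> n = \<phi>' n'"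
    using assms(3) by blast
  show "t = \<phi> n" if ex: "\<exists>n E f A \<phi>. HN_filtration D P X n E f A \<phi> \<and> t = \<phi> n" for t
  proof -
    obtain n' E' f' A' \<phi>' where "HN_filtration D P X n' E' f' A' \<phi>'" "t = \<phi>' n'"
      using ex by blast
    then show ?thesis
      using HN_phase_minus_ge[OF assms(1,2) assms(3)] HN_phase_minus_ge[OF assms(1,2) _ assms(3)]
      by (metis order_antisym)
  qed
qed

text \<open>The filtration with one step N -> X, where \<open>N\<close> is zero and the cone is
  \<open>X\<close> itself, is a Harder-Narasimhan filtration.\<close>

lemma semistable_phases:
  assumes "slicing D P" "\<not> zero_object D X" "X \<in> P \<phi>"
  shows "phase_plus D P X = \<phi>" "phase_minus D P X = \<phi>"
proof -
  obtain N where N: "zero_object D N" using zero_object_exists by blast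
  have X: "X \<in> Ob D" using assms slicing_Ob by blast
  obtain h where "Dist D N X X (Zero_mor D N X) (Idt D X) h" using Dist_zero_left[OF X N] by blast
  then have "HN_filtration D P X 1 (\<lambda>k. if k = 0 then N else X) (\<lambda>_. Zero_mor D N X) (\<lambda>_. X) (\<lambda>_. \<phi>)"
    using N assms by (auto simp: HN_filtration_def)
  then show "phase_plus D P X = \<phi>" "phase_minus D P X = \<phi>"
    using phase_plus_HN phase_minus_HN assms(1,2) by blast+
qed

section \<open>Additivity of classes in the Grothendieck group\<close>

lemma K_class_in: "X \<in> Ob D \<Longrightarrow> K_class D X \<in> carrier (K_group D)"
proof -
  assume "X \<in> Ob D"
  then have "frag_of X \<in> carrier (free_Abelian_group (Ob D))"
    by (simp add: free_Abelian_group_def)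
  then show ?thesis by (auto simp: K_class_def K_group_def FactGroup_def RCOSETS_def)
qed

text \<open>The defining relation puts the generator of \<open>Y\<close> and the sum of those of
  \<open>X\<close> and \<open>Z\<close> into one coset; by normality the coset of a sum is the
  product of the cosets.\<close>

lemma K_class_Dist:
  assumes "Dist D X Y Z f g h"
  shows "K_class D Y = K_class D X \<otimes>\<^bsub>K_group D\<^esub> K_class D Z"
proof -
  let ?G = "free_Abelian_group (Ob D)"
  let ?R = "{frag_of Y - frag_of X - frag_of Z | X Y Z. \<exists>f g h. Dist D X Y Z f g h}"
  interpret G: comm_group ?G by (rule abelian_free_Abelian_group)
  have Ob: "X \<in> Ob D" "Y \<in> Ob D" "Z \<in> Ob D" using Dist_in[OF assms] by auto
  have "?R \<subseteq> carrier ?G"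
  proof clarify
    fix X Y Z f g h assume "Dist D X Y Z f g h"
    then have "X \<in> Ob D" "Y \<in> Ob D" "Z \<in> Ob D" using Dist_in by blast+
    then show "frag_of Y - frag_of X - frag_of Z \<in> carrier ?G"
      by (auto simp: free_Abelian_group_def dest!: subsetD[OF keys_diff])
  qed
  then have sub: "subgroup (K_relations D) ?G"
    unfolding K_relations_def by (rule G.generate_is_subgroup)
  then have normal: "K_relations D \<lhd> ?G" by (simp add: G.normal_iff_subgroup)
  have frag: "frag_of X \<in> carrier ?G" "frag_of Y \<in> carrier ?G" "frag_of Z \<in> carrier ?G"
    using Ob by (auto simp: free_Abelian_group_def)
  have "frag_of Y - frag_of X - frag_of Z \<in> K_relations D"
    unfolding K_relations_def using assms by (intro generate.incl) blast
  then have "frag_of Y \<in> K_relations D #>\<^bsub>?G\<^esub> (frag_of X \<otimes>\<^bsub>?G\<^esub> frag_of Z)"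
    by (force simp: r_coset_def free_Abelian_group_def)
  then have "K_relations D #>\<^bsub>?G\<^esub> (frag_of X \<otimes>\<^bsub>?G\<^esub> frag_of Z) = K_class D Y"
    unfolding K_class_def using G.repr_independence[OF _ G.m_closed[OF frag(1,3)] sub] by blast
  then show ?thesis
    using normal.rcos_sum[OF normal frag(1,3)] by (simp add: K_class_def K_group_def FactGroup_def)
qed

lemma class_Dist:
  assumes "cl \<in> hom (K_group D) type_group" "Dist D X Y Z f g h"
  shows "cl (K_class D Y) = cl (K_class D X) + cl (K_class D Z)"
  using K_class_Dist[OF assms(2)] hom_mult[OF assms(1)] K_class_in Dist_in[OF assms(2)]
  by (simp add: type_group_def)

text \<open>TR1 gives a triangle with all three objects equal to \<open>X\<close>, so its class
  equals twice itself.\<close>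

lemma class_zero_object:
  assumes "cl \<in> hom (K_group D) type_group" "zero_object D X"
  shows "cl (K_class D X) = 0"
proof -
  have "X \<in> Ob D" using assms(2) by (simp add: zero_object_def)
  from class_Dist[OF assms(1) TR1_Idt[OF this assms(2)]] show ?thesis by simp
qed

lemma class_HN:
  assumes "cl \<in> hom (K_group D) type_group" "HN_filtration D P X n E f A \<phi>"
  shows "cl (K_class D X) = (\<Sum>k=1..n. cl (K_class D (A k)))"
proof -
  note H = HN_filtrationD[OF assms(2)]
  have "cl (K_class D (E m)) = (\<Sum>k=1..m. cl (K_class D (A k)))" if "m \<le> n" for m
    using that
  proof (induction m)
    case 0
    then show ?case using class_zero_object[OF assms(1) H(1)] by simp
  next
    case (Suc m)
    then show ?case using class_Dist[OF assms(1)] H(3)[of "Suc m"] by fastforce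
  qed
  then show ?thesis using H(2) by blast
qed

text \<open>The phases strictly decrease, so the extreme ones agree exactly when there is a single
  factor. Later arguments use these data and not the filtration itself.\<close>

lemma HN_exists:
  assumes P: "slicing D P" and cl: "cl \<in> hom (K_group D) type_group"
    and X: "X \<in> Ob D" "\<not> zero_object D X"
  shows "\<exists>(n::nat) A \<phi>. 1 \<le> n \<and> (phase_plus D P X = phase_minus D P X \<longleftrightarrow> n = 1) \<and>
    cl (K_class D X) = (\<Sum>k=1..n. cl (K_class D (A k))) \<and>
    (\<forall>k\<in>{1..n}. A k \<in> P (\<phi> k) \<and> \<not> zero_object D (A k) \<and>
       phase_minus D P X \<le> \<phi> k \<and> \<phi> k \<le> phase_plus D P X)"
proof -
  obtain n E f A \<phi> where HN: "HN_filtration D P X n E f A \<phi>"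
  proof -
    have "\<forall>X\<in>Ob D. \<not> zero_object D X \<longrightarrow> (\<exists>n E f A \<phi>. HN_filtration D P X n E f A \<phi>)"
      using P by (simp add: slicing_def)
    then show ?thesis using X that by blast
  qed
  note H = HN_filtrationD[OF HN]
  have n: "1 \<le> n" using HN_length_pos[OF HN X(2)] .
  have pp: "phase_plus D P X = \<phi> 1" and pm: "phase_minus D P X = \<phi> n"
    using phase_plus_HN[OF P X(2) HN] phase_minus_HN[OF P X(2) HN] .
  have "\<phi> 1 = \<phi> n \<longleftrightarrow> n = 1" using H(6)[of 1 n] n by force
  moreover have "\<phi> n \<le> \<phi> k" "\<phi> k \<le> \<phi> 1" if "k \<in> {1..n}" for k
    using H(7)[of k n] H(7)[of 1 k] that n by auto
  ultimately show ?thesis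
    using n class_HN[OF cl HN] H(4,5) unfolding pp pm
    by (intro exI[of _ n] exI[of _ A] exI[of _ \<phi>]) simp
qed

end

section \<open>Coordinates on \<open>\<Gamma>\<^sub>\<real>\<close>\<close>

lemma real_extension_additive:
  assumes "Modules.additive Z"
  shows "linear (real_extension Z)" "real_extension Z (lattice_incl g) = Z g"
  using theI'[OF real_extension_unique_exists[OF assms]] by (auto simp: real_extension_def)

lemma additive_lattice_incl: "Modules.additive lattice_incl"
  by (simp add: Modules.additive_def tensor_add_left)

text \<open>Basis and coordinates are transported through an isomorphism \<open>f\<close> with a
  standard free abelian group, whose inverse is \<open>h\<close>.\<close>

lemma lattice_basis:
  assumes "free_of_finite_rank TYPE('g::ab_group_add)"
  obtains n :: nat and e :: "nat \<Rightarrow> 'g::ab_group_add" and a :: "nat \<Rightarrow> 'g::ab_group_add \<Rightarrow> int"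
  where "\<And>i. Modules.additive (a i)"
    and "\<And>i j. j < n \<Longrightarrow> a i (e j) = (if i = j then 1 else 0)"
    and "\<And>g. g \<noteq> 0 \<Longrightarrow> \<exists>i<n. a i g \<noteq> 0"
    and "\<And>g. lattice_incl g = (\<Sum>i<n. of_int (a i g) *\<^sub>R lattice_incl (e i))"
proof -
  obtain n f where f: "f \<in> iso (type_group :: 'g monoid) (free_Abelian_group {..<n::nat})"
    using assms unfolding free_of_finite_rank_def is_iso_def by blast
  then have hom: "f (g + h) = f g + f h" for g h
    using hom_mult[of f "type_group :: 'g monoid" "free_Abelian_group {..<n::nat}" g h]
    by (simp add: iso_def type_group_def)
  have bij: "bij_betw f UNIV {c. Poly_Mapping.keys c \<subseteq> {..<n}}"
    using f by (simp add: iso_def type_group_def free_Abelian_group_def)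
  have f0: "f 0 = 0" using hom[of 0 0] by simp
  define h where "h = inv_into UNIV f"
  have fh: "f (h c) = c" if "Poly_Mapping.keys c \<subseteq> {..<n}" for c
    using bij that unfolding h_def by (simp add: bij_betw_inv_into_right)
  have hf: "h (f g) = g" for g
    using bij unfolding h_def by (simp add: bij_betw_inv_into_left)
  have fdiff: "f (g - g') = f g - f g'" for g g'
    using hom[of "g - g'" g'] by simp
  have h_diff: "h (c - d) = h c - h d"
    if "Poly_Mapping.keys c \<subseteq> {..<n}" "Poly_Mapping.keys d \<subseteq> {..<n}" for c d
    using fdiff[of "h c" "h d"] fh[OF that(1)] fh[OF that(2)] hf by metis
  define a where "a i g = Poly_Mapping.lookup (f g) i" for i g
  define e where "e i = h (frag_of i)" for i
  show ?thesis
  proof (rule that)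
    show "Modules.additive (a i)" for i
      by (simp add: Modules.additive_def a_def hom lookup_add)
    show "a i (e j) = (if i = j then 1 else 0)" if "j < n" for i j
      using fh[of "frag_of j"] that by (simp add: a_def e_def lookup_single when_def)
    show "\<exists>i<n. a i g \<noteq> 0" if "g \<noteq> 0" for g
    proof (rule ccontr)
      assume *: "\<not> (\<exists>i<n. a i g \<noteq> 0)"
      have "Poly_Mapping.keys (f g) \<subseteq> {..<n}" using bij by (auto simp: bij_betw_def)
      then have "f g = f 0"
        using * unfolding f0 a_def by (intro poly_mapping_eqI) (auto simp: in_keys_iff)
      then show False using hf that by metis
    qed
    show "lattice_incl g = (\<Sum>i<n. of_int (a i g) *\<^sub>R lattice_incl (e i))" for g
    proof -
      interpret L: Modules.additive "lattice_incl :: 'g \<Rightarrow> _" by (rule additive_lattice_incl)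
      \<comment> \<open>The support condition is carried through the induction because
        \<open>h\<close> is known to respect differences only on elements supported in
        {..<n}.\<close>
      have "Poly_Mapping.keys c \<subseteq> {..<n} \<and>
          lattice_incl (h c) = (\<Sum>i<n. of_int (Poly_Mapping.lookup c i) *\<^sub>R lattice_incl (e i))"
        if "Poly_Mapping.keys c \<subseteq> {..<n}" for c
        using that
      proof (induction c rule: frag_induction)
        case zero
        have "h 0 = 0" using hf[of 0] f0 by simp
        then show ?case by (simp add: L.zero)
      next
        case (one x)
        then have "(\<Sum>i<n. of_int (Poly_Mapping.lookup (frag_of x) i) *\<^sub>R lattice_incl (e i)) =
            (\<Sum>i<n. if i = x then lattice_incl (e x) else 0)"
          by (intro sum.cong) (auto simp: lookup_single when_def)
        then show ?case using one by (simp add: e_def)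
      next
        case (diff c d)
        then show ?case
          using keys_diff[of c d] h_diff[of c d]
          by (auto simp: L.diff lookup_minus scaleR_diff_left sum_subtractf)
      qed
      moreover have "Poly_Mapping.keys (f g) \<subseteq> {..<n}" using bij by (auto simp: bij_betw_def)
      ultimately have "lattice_incl (h (f g)) =
          (\<Sum>i<n. of_int (Poly_Mapping.lookup (f g) i) *\<^sub>R lattice_incl (e i))"
        by blast
      then show ?thesis unfolding hf a_def .
    qed
  qed
qed

text \<open>The integral coordinates are extended real-linearly. They stay integers on the lattice,
  whence the lower bound 1 at nonzero elements: this is the discreteness of \<Gamma> on which the
  descent rests.\<close>

lemma realification_basis:
  assumes "free_of_finite_rank TYPE('g::ab_group_add)"
  obtains n :: nat and e :: "nat \<Rightarrow> 'g::ab_group_add" and x :: "nat \<Rightarrow> 'g::ab_group_add realification \<Rightarrow> real"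
  where "\<And>i. linear (x i)"
    and "\<And>v. v = (\<Sum>i<n. x i v *\<^sub>R lattice_incl (e i))"
    and "\<And>i j. j < n \<Longrightarrow> x i (lattice_incl (e j)) = (if i = j then 1 else 0)"
    and "\<And>g. g \<noteq> 0 \<Longrightarrow> 1 \<le> (\<Sum>i<n. \<bar>x i (lattice_incl g)\<bar>)"
proof -
  obtain n e and a :: "nat \<Rightarrow> 'g \<Rightarrow> int" where a: "\<And>i. Modules.additive (a i)"
    and ae: "\<And>i j. j < n \<Longrightarrow> a i (e j) = (if i = j then 1 else 0)"
    and nz: "\<And>g. g \<noteq> 0 \<Longrightarrow> \<exists>i<n. a i g \<noteq> 0"
    and exp: "\<And>g. lattice_incl g = (\<Sum>i<n. of_int (a i g) *\<^sub>R lattice_incl (e i))"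
    by (rule lattice_basis[OF assms]) (rule that)
  \<comment> \<open>\<open>real_extension\<close> is complex valued; the coordinates are real on the
    lattice, so taking real parts loses nothing.\<close>
  define x where "x i v = Re (real_extension (\<lambda>g. of_int (a i g)) v)" for i v
  have add: "Modules.additive (\<lambda>g. of_int (a i g) :: complex)" for i
    using a[of i] by (simp add: Modules.additive_def)
  have lin: "linear (x i)" for i
    using real_extension_additive(1)[OF add, of i]
    by (auto simp: x_def linear_iff)
  have xg: "x i (lattice_incl g) = of_int (a i g)" for i g
    by (simp add: x_def real_extension_additive(2)[OF add])
  show ?thesis
  proof (rule that)
    show "linear (x i)" for i by (rule lin)
    show "x i (lattice_incl (e j)) = (if i = j then 1 else 0)" if "j < n" for i j
      using ae[OF that] by (simp add: xg)
    show "v = (\<Sum>i<n. x i v *\<^sub>R lattice_incl (e i))" for v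
    proof -
      have "linear (\<lambda>v. \<Sum>i<n. x i v *\<^sub>R lattice_incl (e i))"
        by (intro linear_compose_sum ballI)
          (simp add: linear_iff linear_add[OF lin] linear_scale[OF lin] scaleR_add_left)
      moreover have "w = (\<Sum>i<n. x i w *\<^sub>R lattice_incl (e i))" if "w \<in> range lattice_incl" for w
        using that by (auto simp: xg exp[symmetric])
      ultimately show ?thesis
        using linear_eq_on_span[OF linear_id, of _ "range lattice_incl" v]
        by (auto simp: span_lattice_incl id_def)
    qed
    show "1 \<le> (\<Sum>i<n. \<bar>x i (lattice_incl g)\<bar>)" if g: "g \<noteq> 0" for g
    proof -
      obtain i where i: "i < n" "a i g \<noteq> 0" using nz[OF g] by blast
      then have "1 \<le> \<bar>x i (lattice_incl g)\<bar>" by (simp add: xg)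
      also have "\<dots> \<le> (\<Sum>i<n. \<bar>x i (lattice_incl g)\<bar>)"
        using i by (intro member_le_sum) auto
      finally show ?thesis .
    qed
  qed
qed

text \<open>One half of the equivalence of norms in finite dimension: \<open>f\<close> is continuous
  and positive on the compact unit sphere \<open>K\<close> of the coordinate sum, so it has a
  positive minimum there, and homogeneity does the rest.\<close>

lemma norm_ge_coordinate_sum:
  fixes n :: nat and N :: "'v::real_vector \<Rightarrow> real" and x :: "nat \<Rightarrow> 'v \<Rightarrow> real"
  assumes N: "is_norm N"
    and lin: "\<And>i. linear (x i)"
    and exp: "\<And>v. v = (\<Sum>i<n. x i v *\<^sub>R e i)"
    and dual: "\<And>i j. j < n \<Longrightarrow> x i (e j) = (if i = j then 1 else 0)"
  shows "\<exists>\<kappa>>0. \<forall>v. \<kappa> * (\<Sum>i<n. \<bar>x i v\<bar>) \<le> N v"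
proof -
  have N_add: "N (v + w) \<le> N v + N w" and N_scale: "N (r *\<^sub>R v) = \<bar>r\<bar> * N v"
    and N_nonneg: "0 \<le> N v" and N_0: "N v = 0 \<longleftrightarrow> v = 0" for v w r
    using N by (auto simp: is_norm_def)
  have N_zero: "N 0 = 0" using N_0[of 0] by blast
  have N_sum: "N (\<Sum>i\<in>S. v i) \<le> (\<Sum>i\<in>S. N (v i))" for S :: "nat set" and v
  proof (induction S rule: infinite_finite_induct)
    case (insert i S)
    then show ?case using N_add[of "v i" "\<Sum>i\<in>S. v i"] by simp
  qed (simp_all add: N_zero)
  define comb where "comb y = (\<Sum>i<n. y i *\<^sub>R e i)" for y
  define f where "f y = N (comb y)" for y
  have N_diff: "\<bar>N v - N w\<bar> \<le> N (v - w)" for v w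
  proof -
    have "N v \<le> N (v - w) + N w" "N w \<le> N (w - v) + N v"
      using N_add[of "v - w" w] N_add[of "w - v" v] by simp_all
    moreover have "N (w - v) = N (v - w)" using N_scale[of "-1" "v - w"] by simp
    ultimately show ?thesis by linarith
  qed
  have f_diff: "\<bar>f y - f y0\<bar> \<le> (\<Sum>i<n. \<bar>y i - y0 i\<bar> * N (e i))" for y y0
  proof -
    have "\<bar>f y - f y0\<bar> \<le> N (\<Sum>i<n. (y i - y0 i) *\<^sub>R e i)"
      using N_diff[of "comb y" "comb y0"] by (simp add: f_def comb_def scaleR_diff_left sum_subtractf)
    also have "\<dots> \<le> (\<Sum>i<n. N ((y i - y0 i) *\<^sub>R e i))" by (rule N_sum)
    finally show ?thesis by (simp add: N_scale)
  qed
  have coord: "continuous_on UNIV (\<lambda>y::nat \<Rightarrow> real. y i)" for i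
    by (rule continuous_on_product_coordinates)
  have cont: "continuous_on UNIV f"
    unfolding continuous_on_def
  proof
    fix y0 :: "nat \<Rightarrow> real"
    have "continuous_on UNIV (\<lambda>y. \<Sum>i<n. \<bar>y i - y0 i\<bar> * N (e i))"
      by (intro continuous_intros coord)
    then have "((\<lambda>y. \<Sum>i<n. \<bar>y i - y0 i\<bar> * N (e i)) \<longlongrightarrow> (\<Sum>i<n. \<bar>y0 i - y0 i\<bar> * N (e i))) (at y0 within UNIV)"
      unfolding continuous_on_def by blast
    then have "((\<lambda>y. \<Sum>i<n. \<bar>y i - y0 i\<bar> * N (e i)) \<longlongrightarrow> 0) (at y0 within UNIV)" by simp
    then have "((\<lambda>y. f y - f y0) \<longlongrightarrow> 0) (at y0 within UNIV)"
      by (rule Lim_null_comparison[rotated]) (simp add: f_diff)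
    then show "(f \<longlongrightarrow> f y0) (at y0 within UNIV)"
      by (simp add: LIM_zero_iff)
  qed
  \<comment> \<open>Coordinate vectors are functions on all naturals; setting the entries from
    \<open>n\<close> on to 0 makes the box a product of compact sets.\<close>
  define box where "box = (\<Pi>\<^sub>E i\<in>UNIV. if i < n then {-1..1::real} else {0})"
  define K where "K = box \<inter> {y. (\<Sum>i<n. \<bar>y i\<bar>) = 1}"
  have "compactin (product_topology (\<lambda>i. euclidean) UNIV) box"
    unfolding box_def by (subst compactin_PiE) auto
  then have "compact box" by (simp add: euclidean_product_topology)
  moreover have "closed {y::nat \<Rightarrow> real. (\<Sum>i<n. \<bar>y i\<bar>) = 1}"
    by (intro closed_Collect_eq continuous_intros coord)
  ultimately have "compact K" unfolding K_def by (rule compact_Int_closed)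
  have pos: "f y > 0" if "y \<in> K" for y
  proof -
    have "comb y \<noteq> 0"
    proof
      assume 0: "comb y = 0"
      have "y i = 0" if "i < n" for i
      proof -
        have "x i (comb y) = (\<Sum>j<n. y j * x i (e j))"
          by (simp add: comb_def linear_sum[OF lin] linear_scale[OF lin])
        also have "\<dots> = (\<Sum>j<n. if j = i then y i else 0)"
          by (intro sum.cong) (auto simp: dual)
        also have "\<dots> = y i" using that by simp
        finally show ?thesis using 0 linear_0[OF lin] by simp
      qed
      then show False using \<open>y \<in> K\<close> by (simp add: K_def)
    qed
    then have "f y \<noteq> 0" unfolding f_def N_0 .
    then show ?thesis using N_nonneg[of "comb y"] by (simp add: f_def)
  qed
  have "\<exists>\<kappa>>0. \<forall>y\<in>K. \<kappa> \<le> f y"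
  proof (cases "K = {}")
    case True
    \<comment> \<open>The sphere is empty when \<open>n\<close> is 0; any positive constant then
      serves.\<close>
    then show ?thesis by (intro exI[of _ 1]) simp
  next
    case False
    then obtain y where "y \<in> K" "\<forall>y'\<in>K. f y \<le> f y'"
      using continuous_attains_inf[OF \<open>compact K\<close>, of f] continuous_on_subset[OF cont] by blast
    then show ?thesis using pos by blast
  qed
  then obtain \<kappa> where "\<kappa> > 0" and \<kappa>: "\<And>y. y \<in> K \<Longrightarrow> \<kappa> \<le> f y" by blast
  have "\<kappa> * (\<Sum>i<n. \<bar>x i v\<bar>) \<le> N v" for v
  proof (cases "(\<Sum>i<n. \<bar>x i v\<bar>) = 0")
    case True
    then show ?thesis using N_nonneg by simp
  next
    case False
    define s where "s = (\<Sum>i<n. \<bar>x i v\<bar>)"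
    have s: "s > 0" using False unfolding s_def by (simp add: order_less_le sum_nonneg)
    define y where "y i = (if i < n then x i v / s else 0)" for i
    have sum_y: "(\<Sum>i<n. \<bar>y i\<bar>) = 1"
    proof -
      have "(\<Sum>i<n. \<bar>y i\<bar>) = (\<Sum>i<n. \<bar>x i v\<bar> / s)"
        using s by (intro sum.cong) (auto simp: y_def)
      then show ?thesis using s by (simp add: sum_divide_distrib[symmetric] s_def[symmetric])
    qed
    have "y i \<in> (if i < n then {-1..1} else {0})" for i
    proof (cases "i < n")
      case True
      then have "\<bar>y i\<bar> \<le> 1"
        unfolding sum_y[symmetric] by (intro member_le_sum) auto
      then show ?thesis using True by (simp add: abs_le_iff)
    qed (simp add: y_def)
    then have "y \<in> K" unfolding K_def box_def using sum_y by blast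
    have "v = s *\<^sub>R comb y"
    proof -
      have "s *\<^sub>R comb y = (\<Sum>i<n. x i v *\<^sub>R e i)"
        unfolding comb_def scaleR_sum_right using s by (intro sum.cong) (auto simp: y_def)
      also have "\<dots> = v" by (rule exp[symmetric])
      finally show ?thesis by (rule sym)
    qed
    then have "N v = s * f y" using s N_scale[of s "comb y"] by (simp add: f_def)
    then show ?thesis using \<kappa>[OF \<open>y \<in> K\<close>] s by (simp add: s_def[symmetric] mult.commute)
  qed
  then show ?thesis using \<open>\<kappa> > 0\<close> by blast
qed

lemma norm_linear_le_coordinate_sum:
  fixes n :: nat and F :: "'v::real_vector \<Rightarrow> 'w::real_normed_vector"
  assumes "linear F" and exp: "\<And>v. v = (\<Sum>i<n. x i v *\<^sub>R e i)"
  shows "norm (F v) \<le> (\<Sum>i<n. norm (F (e i))) * (\<Sum>i<n. \<bar>x i v\<bar>)"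
proof -
  have "norm (F v) = norm (\<Sum>i<n. x i v *\<^sub>R F (e i))"
    by (subst exp) (simp add: linear_sum[OF assms(1)] linear_scale[OF assms(1)])
  also have "\<dots> \<le> (\<Sum>i<n. \<bar>x i v\<bar> * norm (F (e i)))"
    by (rule order_trans[OF norm_sum]) simp
  also have "\<dots> \<le> (\<Sum>i<n. \<bar>x i v\<bar> * (\<Sum>i<n. norm (F (e i))))"
    by (intro sum_mono mult_left_mono member_le_sum) auto
  finally show ?thesis by (simp add: sum_distrib_right mult.commute)
qed

lemma bilinear_le_coordinate_sum:
  fixes n :: nat and b :: "'v::real_vector \<Rightarrow> 'v \<Rightarrow> real"
  assumes b: "bilinear b" and exp: "\<And>v. v = (\<Sum>i<n. x i v *\<^sub>R e i)"
  shows "\<bar>b v w\<bar> \<le> (\<Sum>i<n. \<Sum>j<n. \<bar>b (e j) (e i)\<bar>) * (\<Sum>i<n. \<bar>x i v\<bar>) * (\<Sum>i<n. \<bar>x i w\<bar>)"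
proof -
  have l: "linear (b v)" "linear (\<lambda>v. b v u)" for u using b by (auto simp: bilinear_def)
  have "\<bar>b v w\<bar> \<le> (\<Sum>i<n. \<bar>b v (e i)\<bar>) * (\<Sum>i<n. \<bar>x i w\<bar>)"
    using norm_linear_le_coordinate_sum[OF l(1) exp, of w] by simp
  also have "\<dots> \<le> (\<Sum>i<n. (\<Sum>j<n. \<bar>b (e j) (e i)\<bar>) * (\<Sum>i<n. \<bar>x i v\<bar>)) * (\<Sum>i<n. \<bar>x i w\<bar>)"
    using norm_linear_le_coordinate_sum[OF l(2) exp, of v]
    by (intro mult_right_mono sum_mono) (auto simp: sum_nonneg)
  finally show ?thesis by (simp add: sum_distrib_right)
qed

section \<open>Quadratic forms and sectors\<close>

text \<open>Put u = v - w and let u0 be a small lift of Z u. Then u - u0 lies in the kernel of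
  \<open>Z\<close>, so b(u, u) is at most 2 b(u, u0) - b(u0, u0), which is of order \<kappa>. The
  bound follows from 2 b(v, w) = b(v, v) + b(w, w) - b(u, u).\<close>

lemma bilinear_almost_nonneg:
  fixes nu :: "'v::real_vector \<Rightarrow> real" and Z :: "'v \<Rightarrow> complex"
  assumes nu_add: "\<And>v w. nu (v + w) \<le> nu v + nu w"
    and nu_scale: "\<And>r v. nu (r *\<^sub>R v) = \<bar>r\<bar> * nu v"
    and Z: "linear Z"
    and b: "bilinear b" "\<And>v w. b v w = b w v"
    and B: "\<And>v w. \<bar>b v w\<bar> \<le> B * nu v * nu w" "0 \<le> B"
    and ker: "\<And>v. Z v = 0 \<Longrightarrow> b v v \<le> 0"
    and K: "0 \<le> K"
  shows "\<exists>C\<ge>0. \<forall>v w \<kappa>. 0 \<le> b v v \<longrightarrow> 0 \<le> b w w \<longrightarrow> nu v \<le> K \<longrightarrow> nu w \<le> K \<longrightarrow>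
           \<kappa> \<le> 1 \<longrightarrow> norm (Z v - Z w) \<le> \<kappa> \<longrightarrow> - C * \<kappa> \<le> b v w"
proof -
  have nu_nonneg: "0 \<le> nu v" for v
    using nu_add[of v "- v"] nu_scale[of 0 v] nu_scale[of "-1" v] by simp
  \<comment> \<open>\<open>s\<close> lifts values of \<open>Z\<close> linearly; its values at 1 and
    \<i> control \<open>nu\<close> of every lift.\<close>
  obtain s where s: "linear s" "\<And>x. x \<in> Z ` UNIV \<Longrightarrow> Z (s x) = x"
    using linear_exists_right_inverse_on[OF Z subspace_UNIV] by blast
  define S where "S = nu (s 1) + nu (s \<i>)"
  have S0: "0 \<le> S" by (simp add: S_def nu_nonneg)
  have s_bound: "nu (s x) \<le> S * norm x" for x
  proof -
    have "x = Re x *\<^sub>R 1 + Im x *\<^sub>R \<i>"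
      by (simp add: complex_eq_iff)
    then have "s x = s (Re x *\<^sub>R 1 + Im x *\<^sub>R \<i>)" by (rule arg_cong)
    also have "\<dots> = Re x *\<^sub>R s 1 + Im x *\<^sub>R s \<i>"
      using s(1) by (simp add: linear_add linear_scale)
    finally have "nu (s x) \<le> \<bar>Re x\<bar> * nu (s 1) + \<bar>Im x\<bar> * nu (s \<i>)"
      by (metis nu_add nu_scale)
    also have "\<dots> \<le> norm x * nu (s 1) + norm x * nu (s \<i>)"
      by (intro add_mono mult_right_mono abs_Re_le_cmod abs_Im_le_cmod nu_nonneg)
    finally show ?thesis by (simp add: S_def algebra_simps)
  qed
  \<comment> \<open>The two summands bound 2 b(u, u0) and - b(u0, u0) in units of \<kappa>.\<close>
  define C where "C = B * (2 * K * S) * 2 + B * S * S"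
  show ?thesis
  proof (intro exI conjI allI impI)
    show "0 \<le> C" using S0 B K by (simp add: C_def)
    fix v w \<kappa>
    assume vw: "0 \<le> b v v" "0 \<le> b w w" "nu v \<le> K" "nu w \<le> K" and \<kappa>: "\<kappa> \<le> 1" "norm (Z v - Z w) \<le> \<kappa>"
    define u where "u = v - w"
    define u0 where "u0 = s (Z u)"
    have Zu: "norm (Z u) \<le> \<kappa>" using \<kappa> Z by (simp add: u_def linear_diff)
    have \<kappa>0: "0 \<le> \<kappa>" using \<kappa>(2) norm_ge_zero order_trans by blast
    have "Z (u - u0) = 0" using Z s(2)[of "Z u"] by (simp add: u0_def linear_diff)
    then have "b (u - u0) (u - u0) \<le> 0" by (rule ker)
    then have 1: "b u u \<le> 2 * b u u0 - b u0 u0"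
      using b(2)[of u u0] by (simp add: bilinear_lsub[OF b(1)] bilinear_rsub[OF b(1)])
    have nu_u: "nu u \<le> 2 * K"
      using nu_add[of v "- w"] nu_scale[of "-1" w] vw by (simp add: u_def)
    have nu_u0: "nu u0 \<le> S * \<kappa>"
      using s_bound[of "Z u"] mult_left_mono[OF Zu S0] by (simp add: u0_def)
    have "b u u0 \<le> B * nu u * nu u0" using B(1)[of u u0] by simp
    also have "\<dots> \<le> B * (2 * K) * (S * \<kappa>)"
      using nu_u nu_u0 B(2) K nu_nonneg by (intro mult_mono mult_left_mono) auto
    finally have 2: "b u u0 \<le> B * (2 * K) * (S * \<kappa>)" .
    have "- b u0 u0 \<le> B * nu u0 * nu u0" using B(1)[of u0 u0] by simp
    \<comment> \<open>One of the two factors \<kappa> is replaced by 1 to keep the estimate linear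
      in \<kappa>.\<close>
    also have "\<dots> \<le> B * (S * 1) * (S * \<kappa>)"
    proof (intro mult_mono mult_left_mono)
      show "nu u0 \<le> S * 1" using nu_u0 mult_left_mono[OF \<kappa>(1) S0] by simp
    qed (use nu_u0 B(2) S0 nu_nonneg in auto)
    finally have 3: "- b u0 u0 \<le> B * S * (S * \<kappa>)" by simp
    have "b u u \<le> C * \<kappa>"
      using 1 2 3 by (simp add: C_def algebra_simps)
    moreover have "b u u = b v v + b w w - 2 * b v w"
      using b(2)[of v w] by (simp add: u_def bilinear_lsub[OF b(1)] bilinear_rsub[OF b(1)])
    moreover have "0 \<le> C * \<kappa>" using \<open>0 \<le> C\<close> \<kappa>0 by simp
    ultimately show "- C * \<kappa> \<le> b v w"
      using vw by simp
  qed
qed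

text \<open>The closed sector of angle \<pi>/2 around the positive real axis, apex included. Any two
  nonzero elements enclose at most a right angle.\<close>

definition quarter_cone :: "complex set" where
  "quarter_cone = {w. \<bar>Im w\<bar> \<le> Re w}"

lemma zero_in_quarter_cone: "0 \<in> quarter_cone"
  by (simp add: quarter_cone_def)

lemma quarter_cone_add: "u \<in> quarter_cone \<Longrightarrow> w \<in> quarter_cone \<Longrightarrow> u + w \<in> quarter_cone"
  using abs_triangle_ineq[of "Im u" "Im w"] by (auto simp: quarter_cone_def)

lemma quarter_cone_sum: "(\<And>i. i \<in> S \<Longrightarrow> w i \<in> quarter_cone) \<Longrightarrow> sum w S \<in> quarter_cone"
  by (induction S rule: infinite_finite_induct) (auto intro: quarter_cone_add simp: zero_in_quarter_cone)

lemma norm_le_Re_quarter_cone: "w \<in> quarter_cone \<Longrightarrow> norm w \<le> 2 * Re w"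
  using cmod_le[of w] by (auto simp: quarter_cone_def)

text \<open>A reverse triangle inequality: on the cone the modulus is at most twice the real part,
  and real parts add up.\<close>

lemma sum_norm_quarter_cone:
  assumes "\<And>i. i \<in> S \<Longrightarrow> w i \<in> quarter_cone"
  shows "(\<Sum>i\<in>S. norm (w i)) \<le> 2 * norm (sum w S)"
proof -
  have "(\<Sum>i\<in>S. norm (w i)) \<le> (\<Sum>i\<in>S. 2 * Re (w i))"
    by (intro sum_mono norm_le_Re_quarter_cone assms)
  also have "\<dots> = 2 * Re (sum w S)" by (simp add: sum_distrib_left)
  finally show ?thesis using complex_Re_le_cmod[of "sum w S"] by linarith
qed

text \<open>The real inner product of two elements of the cone is nonnegative, because imaginary
  parts are dominated by real parts.\<close>

lemma norm_add_sq_quarter_cone: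
  assumes "u \<in> quarter_cone" "w \<in> quarter_cone"
  shows "(norm u)\<^sup>2 + (norm w)\<^sup>2 \<le> (norm (u + w))\<^sup>2"
proof -
  have "\<bar>Im u * Im w\<bar> \<le> Re u * Re w"
    unfolding abs_mult using assms by (intro mult_mono) (auto simp: quarter_cone_def)
  then have "0 \<le> Re u * Re w + Im u * Im w" by linarith
  then show ?thesis by (simp add: cmod_power2 power2_sum)
qed

lemma norm_sum_sq_quarter_cone:
  assumes "finite S" "\<And>i. i \<in> S \<Longrightarrow> w i \<in> quarter_cone"
  shows "(\<Sum>i\<in>S. (norm (w i))\<^sup>2) \<le> (norm (sum w S))\<^sup>2"
  using assms
proof (induction S)
  case (insert i S)
  then show ?case
    using norm_add_sq_quarter_cone[of "w i" "sum w S"] quarter_cone_sum[of S w] by force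
qed simp

lemma polar_in_quarter_cone:
  assumes "0 \<le> r" "\<bar>x\<bar> \<le> 1 / 4"
  shows "of_real r * exp (\<i> * of_real (pi * x)) \<in> quarter_cone"
proof -
  have x: "\<bar>pi * x\<bar> \<le> pi / 4" using assms mult_left_mono[of "\<bar>x\<bar>" "1/4" pi] by (simp add: abs_mult)
  have "\<bar>sin (pi * x)\<bar> = sin \<bar>pi * x\<bar>"
  proof (cases "0 \<le> pi * x")
    case True
    then show ?thesis using x pi_gt_zero sin_ge_zero[of "pi * x"] by linarith
  next
    case False
    then show ?thesis using x pi_gt_zero sin_ge_zero[of "- (pi * x)"]
      by (simp add: abs_if)
  qed
  also have "\<dots> \<le> sin (pi / 4)"
    using x pi_gt_zero by (subst sin_mono_le_eq) auto
  also have "\<dots> = cos (pi / 4)" by (simp add: sin_45 cos_45)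
  also have "\<dots> \<le> cos \<bar>pi * x\<bar>"
    using x pi_gt_zero by (subst cos_mono_le_eq) auto
  also have "\<dots> = cos (pi * x)" by (simp only: cos_abs_real)
  finally have "r * \<bar>sin (pi * x)\<bar> \<le> r * cos (pi * x)" using assms(1) by (rule mult_left_mono)
  then show ?thesis using assms(1)
    by (simp add: quarter_cone_def Re_exp Im_exp abs_mult)
qed

text \<open>A chord of the unit circle is no longer than its arc.\<close>

lemma norm_cis_diff_le:
  fixes x y :: real
  shows "norm (exp (\<i> * of_real x) - exp (\<i> * of_real y)) \<le> \<bar>x - y\<bar>"
proof -
  have "exp (\<i> * of_real x) - exp (\<i> * of_real y) = exp (\<i> * of_real y) * (exp (\<i> * of_real (x - y)) - 1)"
    by (simp add: exp_add[symmetric] algebra_simps)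
  moreover have "norm (exp (\<i> * of_real (x - y)) - 1) \<le> \<bar>x - y\<bar>"
    using dist_exp_i_1[of "x - y"] abs_sin_x_le_abs_x[of "(x - y) / 2"] by simp
  ultimately show ?thesis by (simp add: norm_mult)
qed


section \<open>Deformation along a path\<close>

text \<open>The numerical content of a Harder-Narasimhan filtration: \<open>r k\<close> is the
  modulus of the central charge of the factor \<open>A k\<close>, and \<epsilon> is a support
  constant relative to \<open>nu\<close>. Semistability of the factors appears as equality of their
  phases.\<close>

definition HN_decomposition :: "'o set \<Rightarrow> ('o \<Rightarrow> 'v::real_vector) \<Rightarrow> ('v \<Rightarrow> real) \<Rightarrow> ('v \<Rightarrow> complex) \<Rightarrow>
    ('o \<Rightarrow> real) \<Rightarrow> ('o \<Rightarrow> real) \<Rightarrow> real \<Rightarrow> 'o \<Rightarrow> nat \<Rightarrow> (nat \<Rightarrow> 'o) \<Rightarrow> (nat \<Rightarrow> real) \<Rightarrow> (nat \<Rightarrow> real) \<Rightarrow> bool" where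
  "HN_decomposition Obj c nu Z pp pm \<epsilon> X n A \<phi> r \<longleftrightarrow>
     1 \<le> n \<and> (pp X = pm X \<longleftrightarrow> n = 1) \<and> c X = (\<Sum>k=1..n. c (A k)) \<and>
     (\<forall>k\<in>{1..n}. A k \<in> Obj \<and> pp (A k) = \<phi> k \<and> pm (A k) = \<phi> k \<and> pm X \<le> \<phi> k \<and> \<phi> k \<le> pp X \<and>
        0 < r k \<and> Z (c (A k)) = of_real (r k) * exp (\<i> * of_real (pi * \<phi> k)) \<and> \<epsilon> * nu (c (A k)) \<le> r k)"

text \<open>What is left of a continuous family when only classes, phases and central charges at
  real times are kept. \<open>b\<close> stands for the polar form of \<open>Q\<close>, and
  \<open>nu\<close> for a seminorm that is at least 1 on nonzero classes of objects.\<close>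

locale semistable_family =
  fixes T :: "real set" and Obj :: "'o set" and c :: "'o \<Rightarrow> 'v::real_vector"
    and nu :: "'v \<Rightarrow> real" and b :: "'v \<Rightarrow> 'v \<Rightarrow> real"
    and z :: "real \<Rightarrow> 'v \<Rightarrow> complex" and pp pm :: "real \<Rightarrow> 'o \<Rightarrow> real"
  assumes nu_add: "nu (v + w) \<le> nu v + nu w"
    and nu_scale: "nu (x *\<^sub>R v) = \<bar>x\<bar> * nu v"
    and bil: "bilinear b" "b v w = b w v"
    and b_bounded: "\<exists>B\<ge>0. \<forall>v w. \<bar>b v w\<bar> \<le> B * nu v * nu w"
    and lin: "t \<in> T \<Longrightarrow> linear (z t)"
    and z_bounded: "t \<in> T \<Longrightarrow> \<exists>L. \<forall>v. norm (z t v) \<le> L * nu v"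
    and z_cont: "t \<in> T \<Longrightarrow> 0 < \<kappa> \<Longrightarrow>
      \<exists>\<delta>>0. \<forall>s\<in>T. \<bar>s - t\<bar> < \<delta> \<longrightarrow> (\<forall>v. norm (z s v - z t v) \<le> \<kappa> * nu v)"
    and ker: "t \<in> T \<Longrightarrow> z t v = 0 \<Longrightarrow> b v v \<le> 0"
    and discrete: "X \<in> Obj \<Longrightarrow> c X \<noteq> 0 \<Longrightarrow> 1 \<le> nu (c X)"
    and phase_cont: "t \<in> T \<Longrightarrow> 0 < \<theta> \<Longrightarrow>
      \<exists>\<delta>>0. \<forall>s\<in>T. \<bar>s - t\<bar> < \<delta> \<longrightarrow>
        (\<forall>X\<in>Obj. \<bar>pp s X - pp t X\<bar> < \<theta> \<and> \<bar>pm s X - pm t X\<bar> < \<theta>)"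
    and HN: "t \<in> T \<Longrightarrow>
      \<exists>\<epsilon>>0. \<forall>X\<in>Obj. \<exists>n A \<phi> r. HN_decomposition Obj c nu (z t) (pp t) (pm t) \<epsilon> X n A \<phi> r"
begin

definition good :: "real \<Rightarrow> bool" where
  "good t \<longleftrightarrow> (\<forall>X\<in>Obj. pp t X = pm t X \<longrightarrow> 0 \<le> b (c X) (c X))"

lemma nu_nonneg: "0 \<le> nu v"
  using nu_add[of v "- v"] nu_scale[of 0 v] nu_scale[of "-1" v] by simp

lemma nu_sum: "nu (\<Sum>i\<in>S. v i) \<le> (\<Sum>i\<in>S. nu (v i))"
proof (induction S rule: infinite_finite_induct)
  case (insert i S)
  then show ?case using nu_add[of "v i" "\<Sum>i\<in>S. v i"] by simp
qed (use nu_scale[of 0 0] in auto)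

text \<open>Equal phases force a single factor, whose central charge is a positive multiple of a
  unit complex number.\<close>

lemma central_charge_nonzero:
  assumes "t \<in> T" "X \<in> Obj" "pp t X = pm t X"
  shows "z t (c X) \<noteq> 0" and "1 \<le> nu (c X)"
proof -
  obtain n A \<phi> r \<epsilon> where H: "HN_decomposition Obj c nu (z t) (pp t) (pm t) \<epsilon> X n A \<phi> r"
    using HN[OF assms(1)] assms(2) by blast
  then have n: "n = 1" using assms(3) by (simp add: HN_decomposition_def)
  then have "c X = c (A 1)" "0 < r 1" "z t (c (A 1)) = of_real (r 1) * exp (\<i> * of_real (pi * \<phi> 1))"
    using H by (auto simp: HN_decomposition_def)
  then show "z t (c X) \<noteq> 0" by simp
  then have "c X \<noteq> 0" using linear_0[OF lin[OF assms(1)]] by metis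
  then show "1 \<le> nu (c X)" by (rule discrete[OF assms(2)])
qed

text \<open>
  If the Harder--Narasimhan phases of an object are confined to an interval of length \<open>1/2\<close>,
  no cancellation occurs, so the support property extends from semistable objects to this one.
\<close>

lemma sector:
  assumes "t \<in> T"
  shows "\<exists>\<epsilon>>0. \<forall>X\<in>Obj. \<forall>\<psi>. pp t X \<le> \<psi> + 1/4 \<longrightarrow> \<psi> - 1/4 \<le> pm t X \<longrightarrow>
    exp (- (\<i> * of_real (pi * \<psi>))) * z t (c X) \<in> quarter_cone \<and>
    \<epsilon> * nu (c X) \<le> 2 * norm (z t (c X))"
proof -
  obtain \<epsilon> where "\<epsilon> > 0" and \<epsilon>:
    "\<forall>X\<in>Obj. \<exists>n A \<phi> r. HN_decomposition Obj c nu (z t) (pp t) (pm t) \<epsilon> X n A \<phi> r"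
    using HN[OF assms] by blast
  have "exp (- (\<i> * of_real (pi * \<psi>))) * z t (c X) \<in> quarter_cone \<and>
      \<epsilon> * nu (c X) \<le> 2 * norm (z t (c X))"
    if X: "X \<in> Obj" and \<psi>: "pp t X \<le> \<psi> + 1/4" "\<psi> - 1/4 \<le> pm t X" for X \<psi>
  proof -
    obtain n A \<phi> r where "HN_decomposition Obj c nu (z t) (pp t) (pm t) \<epsilon> X n A \<phi> r"
      using \<epsilon> X by blast
    then have n: "c X = (\<Sum>k=1..n. c (A k))"
      and A: "\<And>k. k \<in> {1..n} \<Longrightarrow> pm t X \<le> \<phi> k \<and> \<phi> k \<le> pp t X \<and> 0 < r k \<and>
         z t (c (A k)) = of_real (r k) * exp (\<i> * of_real (pi * \<phi> k)) \<and> \<epsilon> * nu (c (A k)) \<le> r k"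
      by (auto simp: HN_decomposition_def)
    define e where "e = exp (- (\<i> * of_real (pi * \<psi>)))"
    have e: "norm e = 1" by (simp add: e_def)
    define w where "w k = e * z t (c (A k))" for k
    have w: "w k \<in> quarter_cone" if "k \<in> {1..n}" for k
    proof -
      have "w k = of_real (r k) * exp (\<i> * of_real (pi * (\<phi> k - \<psi>)))"
        using A[OF that] by (simp add: w_def e_def exp_add[symmetric] algebra_simps)
      moreover have "\<bar>\<phi> k - \<psi>\<bar> \<le> 1/4"
      proof -
        have "pm t X \<le> \<phi> k" "\<phi> k \<le> pp t X" using A[OF that] by auto
        then show ?thesis using \<psi> by linarith
      qed
      moreover have "0 \<le> r k" using A[OF that] by (simp add: less_imp_le)
      ultimately show ?thesis by (metis polar_in_quarter_cone)
    qed
    have sum: "e * z t (c X) = (\<Sum>k=1..n. w k)"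
      by (simp add: n w_def linear_sum[OF lin[OF assms]] sum_distrib_left)
    have "\<epsilon> * nu (c X) \<le> \<epsilon> * (\<Sum>k=1..n. nu (c (A k)))"
      unfolding n using \<open>\<epsilon> > 0\<close> nu_sum by (intro mult_left_mono) auto
    also have "\<dots> \<le> (\<Sum>k=1..n. norm (w k))"
      unfolding sum_distrib_left using A
      by (intro sum_mono) (simp add: w_def e norm_mult less_imp_le)
    also have "\<dots> \<le> 2 * norm (\<Sum>k=1..n. w k)"
      by (rule sum_norm_quarter_cone) (rule w)
    also have "\<dots> = 2 * norm (z t (c X))"
      unfolding sum[symmetric] by (simp add: norm_mult e)
    finally show ?thesis
      using quarter_cone_sum[of "{1..n}" w] w unfolding e_def[symmetric] sum by simp
  qed
  then show ?thesis using \<open>\<epsilon> > 0\<close> by blast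
qed

text \<open>
  A semistable object with negative \<open>Q\<close> stays semistable nearby: otherwise its Harder--Narasimhan
  factors have nonnegative \<open>Q\<close> by assumption and their central charges at \<open>s\<^sub>0\<close> are almost aligned,
  so \<open>Q\<close> of their sum is almost nonnegative.
\<close>

lemma negative_semistable_open:
  assumes s0: "s0 \<in> I" and I: "I \<subseteq> T" and F: "F \<in> Obj" "pp s0 F = pm s0 F"
    and neg: "b (c F) (c F) < 0"
    and Z0: "linear Z0"
    and L: "\<And>s v. s \<in> I \<Longrightarrow> norm (z s v) \<le> L * nu v" "0 \<le> L"
    and \<epsilon>: "0 < \<epsilon>"
    and close: "\<And>s. s \<in> I \<Longrightarrow> pp s F \<le> pp s0 F + 1/6 \<and> pp s0 F - 1/6 \<le> pm s F"
    and sector: "\<And>s X \<psi>. s \<in> I \<Longrightarrow> X \<in> Obj \<Longrightarrow> pp s X \<le> \<psi> + 1/6 \<Longrightarrow> \<psi> - 1/6 \<le> pm s X \<Longrightarrow>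
      exp (- (\<i> * of_real (pi * \<psi>))) * Z0 (c X) \<in> quarter_cone"
    and low: "\<And>s X. s \<in> I \<Longrightarrow> X \<in> Obj \<Longrightarrow> pp s X = pm s X \<Longrightarrow>
      \<epsilon> \<le> norm (Z0 (c X)) \<and> \<epsilon> * nu (c X) \<le> norm (Z0 (c X)) \<and> \<epsilon> * nu (c X) \<le> norm (z s (c X))"
    and IH: "\<And>s X. s \<in> I \<Longrightarrow> X \<in> Obj \<Longrightarrow> pp s X = pm s X \<Longrightarrow>
      (norm (Z0 (c X)))\<^sup>2 \<le> (norm (Z0 (c F)))\<^sup>2 - \<epsilon>\<^sup>2 \<Longrightarrow> 0 \<le> b (c X) (c X)"
  shows "\<exists>e>0. \<forall>s\<in>I. \<bar>s - s0\<bar> < e \<longrightarrow> pp s F = pm s F"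
proof -
  have s0T: "s0 \<in> T" using s0 I by blast
  obtain B where "B \<ge> 0" and B: "\<And>v w. \<bar>b v w\<bar> \<le> B * nu v * nu w" using b_bounded by blast
  have "\<exists>C\<ge>0. \<forall>v w \<kappa>. 0 \<le> b v v \<longrightarrow> 0 \<le> b w w \<longrightarrow> nu v \<le> 1 / \<epsilon> \<longrightarrow> nu w \<le> 1 / \<epsilon> \<longrightarrow>
           \<kappa> \<le> 1 \<longrightarrow> norm (z s0 v - z s0 w) \<le> \<kappa> \<longrightarrow> - C * \<kappa> \<le> b v w"
    by (rule bilinear_almost_nonneg[OF nu_add nu_scale lin[OF s0T] bil B \<open>B \<ge> 0\<close> ker[OF s0T]])
      (use \<epsilon> in auto)
  then obtain C where "C \<ge> 0" and C: "\<And>v w \<kappa>. 0 \<le> b v v \<Longrightarrow> 0 \<le> b w w \<Longrightarrow> nu v \<le> 1 / \<epsilon> \<Longrightarrow> nu w \<le> 1 / \<epsilon> \<Longrightarrow>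
           \<kappa> \<le> 1 \<Longrightarrow> norm (z s0 v - z s0 w) \<le> \<kappa> \<Longrightarrow> - C * \<kappa> \<le> b v w"
    by blast
  \<comment> \<open>A bound, uniform in \<open>s\<close>, for the sum of the \<open>r k\<close> over
    the factors of \<open>F\<close>; see \<open>sum_r\<close>.\<close>
  define R where "R = L * (2 * norm (Z0 (c F)) / \<epsilon>)"
  have "0 \<le> R" using L \<epsilon> by (simp add: R_def)
  define q where "q = - b (c F) (c F)"
  have "q > 0" using neg by (simp add: q_def)
  \<comment> \<open>Chosen so that C \<kappa> R^2 < q; the summand 1 keeps the denominator
    positive.\<close>
  define \<kappa> where "\<kappa> = min 1 (q / (2 * (C * R\<^sup>2 + 1)))"
  have den: "0 < C * R\<^sup>2 + 1" using \<open>C \<ge> 0\<close> by (simp add: add_nonneg_pos)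
  have "\<kappa> > 0" "\<kappa> \<le> 1" using \<open>q > 0\<close> den by (auto simp: \<kappa>_def)
  have small: "C * \<kappa> * R\<^sup>2 < q"
  proof -
    have "C * \<kappa> * R\<^sup>2 \<le> (C * R\<^sup>2 + 1) * \<kappa>" using \<open>\<kappa> > 0\<close> by (simp add: algebra_simps)
    also have "\<dots> \<le> (C * R\<^sup>2 + 1) * (q / (2 * (C * R\<^sup>2 + 1)))"
      using den by (intro mult_left_mono) (auto simp: \<kappa>_def)
    also have "\<dots> = q / 2" using den by (simp add: field_simps)
    also have "\<dots> < q" using \<open>q > 0\<close> by simp
    finally show ?thesis .
  qed
  \<comment> \<open>Both tolerances contribute \<kappa>/4 to \<open>align\<close>: since \<pi> < 4,
    a phase error of \<kappa>/16 is an angle of at most \<kappa>/4, and the \<epsilon> in the second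
    tolerance cancels against nu (v k) \<le> 1/\<epsilon>.\<close>
  obtain e1 where "e1 > 0" and e1: "\<And>s X. s \<in> T \<Longrightarrow> \<bar>s - s0\<bar> < e1 \<Longrightarrow> X \<in> Obj \<Longrightarrow>
      \<bar>pp s X - pp s0 X\<bar> < \<kappa> / 16 \<and> \<bar>pm s X - pm s0 X\<bar> < \<kappa> / 16"
    using phase_cont[OF s0T, of "\<kappa> / 16"] \<open>\<kappa> > 0\<close> by auto
  obtain e2 where "e2 > 0" and e2: "\<And>s v. s \<in> T \<Longrightarrow> \<bar>s - s0\<bar> < e2 \<Longrightarrow>
      norm (z s v - z s0 v) \<le> \<epsilon> * \<kappa> / 4 * nu v"
    using z_cont[OF s0T, of "\<epsilon> * \<kappa> / 4"] \<open>\<kappa> > 0\<close> \<epsilon> by auto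
  have "pp s F = pm s F" if s: "s \<in> I" "\<bar>s - s0\<bar> < min e1 e2" for s
  proof (rule ccontr)
    assume not: "pp s F \<noteq> pm s F"
    have sT: "s \<in> T" using s I by blast
    obtain \<epsilon>' n A \<phi> r where H: "HN_decomposition Obj c nu (z s) (pp s) (pm s) \<epsilon>' F n A \<phi> r"
      using HN[OF sT] F(1) by blast
    then have n: "2 \<le> n" using not by (auto simp: HN_decomposition_def)
    have cF: "c F = (\<Sum>k=1..n. c (A k))"
      and A: "\<And>k. k \<in> {1..n} \<Longrightarrow> A k \<in> Obj \<and> pp s (A k) = \<phi> k \<and> pm s (A k) = \<phi> k \<and>
         pm s F \<le> \<phi> k \<and> \<phi> k \<le> pp s F \<and> 0 < r k \<and>
         z s (c (A k)) = of_real (r k) * exp (\<i> * of_real (pi * \<phi> k))"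
      using H by (auto simp: HN_decomposition_def)
    define \<psi> where "\<psi> = pp s0 F"
    have pmF: "pm s0 F = \<psi>" using F(2) by (simp add: \<psi>_def)
    define e where "e = exp (- (\<i> * of_real (pi * \<psi>)))"
    have e: "norm e = 1" by (simp add: e_def)
    define w where "w k = e * Z0 (c (A k))" for k
    have w: "w k \<in> quarter_cone" if "k \<in> {1..n}" for k
      using sector[OF s(1), of "A k" \<psi>] A[OF that] close[OF s(1)] by (auto simp: w_def e_def \<psi>_def)
    have norm_w: "norm (w k) = norm (Z0 (c (A k)))" for k by (simp add: w_def norm_mult e)
    have sum_w: "norm (\<Sum>k=1..n. w k) = norm (Z0 (c F))"
    proof -
      have "(\<Sum>k=1..n. w k) = e * Z0 (c F)"
        by (simp add: cF w_def linear_sum[OF Z0] sum_distrib_left)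
      then show ?thesis by (simp add: norm_mult e)
    qed
    have lowA: "\<epsilon> \<le> norm (w k) \<and> \<epsilon> * nu (c (A k)) \<le> norm (w k) \<and> \<epsilon> * nu (c (A k)) \<le> r k"
      if "k \<in> {1..n}" for k
    proof -
      have "norm (z s (c (A k))) = r k" using A[OF that] by (simp add: norm_mult)
      then show ?thesis using low[OF s(1), of "A k"] A[OF that] by (simp add: norm_w)
    qed
    have QA: "0 \<le> b (c (A k)) (c (A k))" if k: "k \<in> {1..n}" for k
    proof -
      \<comment> \<open>As \<open>F\<close> is unstable at \<open>s\<close>, there is a second
        factor. It uses up at least \<epsilon>^2 of the squared modulus of Z0 (c F), so
        \<open>IH\<close> applies to \<open>A k\<close>.\<close>
      obtain j where j: "j \<in> {1..n}" "j \<noteq> k"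
        using n that by (cases "k = 1") (auto intro: that[of 1] that[of 2])
      have "(norm (w k))\<^sup>2 + \<epsilon>\<^sup>2 \<le> (norm (w k))\<^sup>2 + (norm (w j))\<^sup>2"
        using lowA[OF j(1)] \<epsilon> by (simp add: power_mono)
      also have "\<dots> = (\<Sum>i\<in>{k,j}. (norm (w i))\<^sup>2)" using j by simp
      also have "\<dots> \<le> (\<Sum>i=1..n. (norm (w i))\<^sup>2)"
        using j k by (intro sum_mono2) auto
      also have "\<dots> \<le> (norm (\<Sum>i=1..n. w i))\<^sup>2"
        using w by (intro norm_sum_sq_quarter_cone) auto
      finally have "(norm (Z0 (c (A k))))\<^sup>2 \<le> (norm (Z0 (c F)))\<^sup>2 - \<epsilon>\<^sup>2"
        unfolding norm_w sum_w by linarith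
      then show ?thesis using A[OF k] IH[OF s(1), of "A k"] by simp
    qed
    \<comment> \<open>Normalised so that z s (v k) is the unit complex number of phase \<phi>
      k.\<close>
    define v where "v k = (1 / r k) *\<^sub>R c (A k)" for k
    have cv: "c (A k) = r k *\<^sub>R v k" if "k \<in> {1..n}" for k
      using A[OF that] by (simp add: v_def)
    have nuv: "nu (v k) \<le> 1 / \<epsilon>" if "k \<in> {1..n}" for k
      using lowA[OF that] A[OF that] \<epsilon> by (simp add: v_def nu_scale field_simps)
    have Qv: "0 \<le> b (v k) (v k)" if "k \<in> {1..n}" for k
      using QA[OF that] A[OF that] by (simp add: v_def bilinear_lmul[OF bil(1)] bilinear_rmul[OF bil(1)])
    have align: "norm (z s0 (v k) - exp (\<i> * of_real (pi * \<psi>))) \<le> \<kappa> / 2" if k: "k \<in> {1..n}" for k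
    proof -
      have zs: "z s (v k) = exp (\<i> * of_real (pi * \<phi> k))"
        using A[OF k] by (simp add: v_def linear_scale[OF lin[OF sT]] scaleR_conv_of_real)
      have "norm (z s (v k) - z s0 (v k)) \<le> \<epsilon> * \<kappa> / 4 * nu (v k)"
        using e2[OF sT] s by simp
      also have "\<dots> \<le> \<epsilon> * \<kappa> / 4 * (1 / \<epsilon>)"
        using nuv[OF k] \<epsilon> \<open>\<kappa> > 0\<close> by (intro mult_left_mono) auto
      finally have 1: "norm (z s0 (v k) - z s (v k)) \<le> \<kappa> / 4" using \<epsilon> by (simp add: norm_minus_commute)
      have "\<bar>\<phi> k - \<psi>\<bar> \<le> \<kappa> / 16"
      proof -
        have "\<bar>pp s F - \<psi>\<bar> < \<kappa> / 16" "\<bar>pm s F - \<psi>\<bar> < \<kappa> / 16"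
          using e1[OF sT _ F(1)] s pmF by (auto simp: \<psi>_def)
        then show ?thesis using A[OF k] by linarith
      qed
      then have "\<bar>pi * \<phi> k - pi * \<psi>\<bar> \<le> pi * (\<kappa> / 16)"
        unfolding right_diff_distrib[symmetric] abs_mult by simp
      also have "\<dots> \<le> 4 * (\<kappa> / 16)"
        using pi_less_4 \<open>\<kappa> > 0\<close> by (intro mult_right_mono) auto
      finally have "norm (z s (v k) - exp (\<i> * of_real (pi * \<psi>))) \<le> \<kappa> / 4"
        unfolding zs using norm_cis_diff_le[of "pi * \<phi> k" "pi * \<psi>"] by linarith
      with 1 show ?thesis
        using norm_triangle_ineq[of "z s0 (v k) - z s (v k)" "z s (v k) - exp (\<i> * of_real (pi * \<psi>))"] by simp
    qed
    \<comment> \<open>Both charges at \<open>s0\<close> lie within \<kappa>/2 of the unit number of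
      phase \<psi>, hence within \<kappa> of each other.\<close>
    have bv: "- C * \<kappa> \<le> b (v k) (v l)" if kl: "k \<in> {1..n}" "l \<in> {1..n}" for k l
    proof (rule C)
      show "norm (z s0 (v k) - z s0 (v l)) \<le> \<kappa>"
        using align[OF kl(1)] align[OF kl(2)]
          norm_triangle_ineq4[of "z s0 (v k) - exp (\<i> * of_real (pi * \<psi>))" "z s0 (v l) - exp (\<i> * of_real (pi * \<psi>))"]
        by simp
    qed (use kl Qv nuv \<open>\<kappa> \<le> 1\<close> in auto)
    have sum_r: "(\<Sum>k=1..n. r k) \<le> R"
    proof -
      have "(\<Sum>k=1..n. r k) \<le> (\<Sum>k=1..n. L * (norm (w k) / \<epsilon>))"
      proof (rule sum_mono)
        fix k assume k: "k \<in> {1..n}"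
        have "r k \<le> L * nu (c (A k))" using L(1)[OF s(1), of "c (A k)"] A[OF k] by (simp add: norm_mult)
        also have "\<dots> \<le> L * (norm (w k) / \<epsilon>)"
          using lowA[OF k] \<epsilon> L(2) by (intro mult_left_mono) (auto simp: field_simps)
        finally show "r k \<le> L * (norm (w k) / \<epsilon>)" .
      qed
      also have "\<dots> = L * ((\<Sum>k=1..n. norm (w k)) / \<epsilon>)"
        by (simp add: sum_distrib_left sum_divide_distrib)
      also have "\<dots> \<le> R"
        unfolding R_def sum_w[symmetric] using L(2) \<epsilon> sum_norm_quarter_cone[of "{1..n}" w] w
        by (intro mult_left_mono divide_right_mono) auto
      finally show ?thesis .
    qed
    \<comment> \<open>Expanding \<open>b\<close> over all pairs of factors bounds its value at c F
      below by - C \<kappa> R^2, which is greater than - q: a contradiction.\<close>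
    have "- q = (\<Sum>k=1..n. \<Sum>l=1..n. r k * r l * b (v k) (v l))"
    proof -
      have "b (c F) (c F) = (\<Sum>(k,l)\<in>{1..n}\<times>{1..n}. b (c (A k)) (c (A l)))"
        unfolding cF by (rule bilinear_sum[OF bil(1)])
      also have "\<dots> = (\<Sum>k=1..n. \<Sum>l=1..n. b (c (A k)) (c (A l)))"
        by (simp add: sum.cartesian_product)
      also have "\<dots> = (\<Sum>k=1..n. \<Sum>l=1..n. r k * r l * b (v k) (v l))"
        by (intro sum.cong refl) (simp add: cv bilinear_lmul[OF bil(1)] bilinear_rmul[OF bil(1)])
      finally show ?thesis by (simp add: q_def)
    qed
    also have "\<dots> \<ge> (\<Sum>k=1..n. \<Sum>l=1..n. r k * r l * (- C * \<kappa>))"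
      using bv A by (intro sum_mono mult_left_mono) (auto simp: less_imp_le)
    finally have "- q \<ge> - (C * \<kappa>) * (\<Sum>k=1..n. r k)\<^sup>2"
      by (simp add: power2_eq_square sum_product sum_distrib_left sum_distrib_right mult_ac sum_negf)
    moreover have "C * \<kappa> * (\<Sum>k=1..n. r k)\<^sup>2 \<le> C * \<kappa> * R\<^sup>2"
    proof -
      have "0 \<le> (\<Sum>k=1..n. r k)" using A by (intro sum_nonneg) (simp add: less_imp_le)
      then show ?thesis
        using sum_r \<open>C \<ge> 0\<close> \<open>\<kappa> > 0\<close> by (intro mult_left_mono power_mono) auto
    qed
    ultimately show False using small by simp
  qed
  then show ?thesis using \<open>e1 > 0\<close> \<open>e2 > 0\<close> by (intro exI[of _ "min e1 e2"]) auto
qed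

text \<open>Descent on the squared modulus of z t0 (c F) in steps of (\<epsilon>/4)^2. Both times
  lie in a connected set \<open>I\<close> around \<open>t0\<close>, so a minimal counterexample at
  one time stays semistable up to the other, where it contradicts goodness.\<close>

lemma good_locally_constant:
  assumes t0: "t0 \<in> T" and T: "is_interval T"
  shows "\<exists>\<delta>>0. \<forall>s\<in>T. \<forall>s'\<in>T. \<bar>s - t0\<bar> < \<delta> \<longrightarrow> \<bar>s' - t0\<bar> < \<delta> \<longrightarrow> good s \<longrightarrow> good s'"
proof -
  obtain \<epsilon> where "\<epsilon> > 0" and \<epsilon>: "\<And>X \<psi>. X \<in> Obj \<Longrightarrow> pp t0 X \<le> \<psi> + 1/4 \<Longrightarrow> \<psi> - 1/4 \<le> pm t0 X \<Longrightarrow>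
    exp (- (\<i> * of_real (pi * \<psi>))) * z t0 (c X) \<in> quarter_cone \<and>
    \<epsilon> * nu (c X) \<le> 2 * norm (z t0 (c X))"
    using sector[OF t0] by blast
  obtain d1 where "d1 > 0" and d1: "\<And>s X. s \<in> T \<Longrightarrow> \<bar>s - t0\<bar> < d1 \<Longrightarrow> X \<in> Obj \<Longrightarrow>
      \<bar>pp s X - pp t0 X\<bar> < 1/12 \<and> \<bar>pm s X - pm t0 X\<bar> < 1/12"
    using phase_cont[OF t0, of "1/12"] by auto
  \<comment> \<open>In the sector the charge at \<open>t0\<close> is at least \<epsilon>/2 times
    \<open>nu\<close>; a perturbation of \<epsilon>/4 leaves \<epsilon>/4 as a common support
    constant.\<close>
  obtain d2 where "d2 > 0" and d2: "\<And>s v. s \<in> T \<Longrightarrow> \<bar>s - t0\<bar> < d2 \<Longrightarrow>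
      norm (z s v - z t0 v) \<le> \<epsilon> / 4 * nu v"
    using z_cont[OF t0, of "\<epsilon> / 4"] \<open>\<epsilon> > 0\<close> by auto
  obtain L0 where L0: "\<And>v. norm (z t0 v) \<le> L0 * nu v" using z_bounded[OF t0] by blast
  define L where "L = \<bar>L0\<bar> + \<epsilon> / 4"
  define d where "d = min d1 d2"
  define I where "I = T \<inter> {t0 - d<..<t0 + d}"
  have "d > 0" using \<open>d1 > 0\<close> \<open>d2 > 0\<close> by (simp add: d_def)
  have I: "s \<in> I \<Longrightarrow> s \<in> T \<and> \<bar>s - t0\<bar> < d1 \<and> \<bar>s - t0\<bar> < d2" for s
    by (auto simp: I_def d_def abs_less_iff)
  have in_I: "s \<in> I \<longleftrightarrow> s \<in> T \<and> \<bar>s - t0\<bar> < d" for s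
    by (auto simp: I_def abs_less_iff)
  have "connected I"
    unfolding I_def using T by (simp add: is_interval_connected_1[symmetric] is_interval_Int is_interval_oo)
  have L: "norm (z s v) \<le> L * nu v" if "s \<in> I" for s v
  proof -
    have "norm (z s v) \<le> norm (z t0 v) + norm (z s v - z t0 v)" by norm
    also have "\<dots> \<le> \<bar>L0\<bar> * nu v + \<epsilon> / 4 * nu v"
      using L0[of v] d2[of s v] I[OF that] mult_right_mono[OF abs_ge_self nu_nonneg, of L0 v]
      by (intro add_mono) auto
    finally show ?thesis by (simp add: L_def algebra_simps)
  qed
  have sect: "exp (- (\<i> * of_real (pi * \<psi>))) * z t0 (c X) \<in> quarter_cone \<and>
      \<epsilon> * nu (c X) \<le> 2 * norm (z t0 (c X))"
    if "s \<in> I" "X \<in> Obj" "pp s X \<le> \<psi> + 1/6" "\<psi> - 1/6 \<le> pm s X" for s X \<psi>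
  proof (rule \<epsilon>)
    have "\<bar>pp s X - pp t0 X\<bar> < 1/12 \<and> \<bar>pm s X - pm t0 X\<bar> < 1/12"
      using d1 I that by blast
    then show "pp t0 X \<le> \<psi> + 1/4" "\<psi> - 1/4 \<le> pm t0 X" using that by linarith+
  qed fact
  have low: "\<epsilon> / 4 \<le> norm (z t0 (c X)) \<and> \<epsilon> / 4 * nu (c X) \<le> norm (z t0 (c X)) \<and>
      \<epsilon> / 4 * nu (c X) \<le> norm (z s (c X))"
    if X: "s \<in> I" "X \<in> Obj" "pp s X = pm s X" for s X
  proof -
    have 1: "1 \<le> nu (c X)" using central_charge_nonzero[of s X] I X by blast
    have 2: "\<epsilon> * nu (c X) \<le> 2 * norm (z t0 (c X))" using sect[OF X(1,2), of "pp s X"] X(3) by simp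
    have "norm (z t0 (c X)) \<le> norm (z s (c X)) + norm (z s (c X) - z t0 (c X))" by norm
    then have 3: "norm (z t0 (c X)) \<le> norm (z s (c X)) + \<epsilon> / 4 * nu (c X)"
      using d2[of s "c X"] I[OF X(1)] by linarith
    have "\<epsilon> * 1 \<le> \<epsilon> * nu (c X)" using 1 \<open>\<epsilon> > 0\<close> by (intro mult_left_mono) auto
    moreover have "\<epsilon> / 4 * nu (c X) = \<epsilon> * nu (c X) / 4" by simp
    ultimately show ?thesis using 2 3 \<open>\<epsilon> > 0\<close> by linarith
  qed
  have cont: "continuous_on I (\<lambda>s. pp s X - pm s X)" if "X \<in> Obj" for X
  proof -
    have "\<exists>\<delta>>0. \<forall>s'\<in>I. dist s' s < \<delta> \<longrightarrow> dist (pp s' X) (pp s X) < \<theta> \<and> dist (pm s' X) (pm s X) < \<theta>"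
      if "s \<in> I" "\<theta> > 0" for s \<theta>
      using phase_cont[of s \<theta>] that I \<open>X \<in> Obj\<close> unfolding dist_real_def by meson
    then have "continuous_on I (\<lambda>s. pp s X)" "continuous_on I (\<lambda>s. pm s X)"
      unfolding continuous_on_iff by meson+
    then show ?thesis by (intro continuous_intros)
  qed
  \<comment> \<open>\<open>k\<close> bounds the number of descent steps left. Time and object are
    generalised in the induction, since the factors arise at other times; for k = 0 a square would
    have to be negative.\<close>
  have claim: "0 \<le> b (c F) (c F)"
    if a: "a \<in> I" "good a" and F: "s \<in> I" "F \<in> Obj" "pp s F = pm s F"
      "(norm (z t0 (c F)))\<^sup>2 < real k * (\<epsilon> / 4)\<^sup>2" for a s F k
    using F
  proof (induction k arbitrary: s F)
    case 0
    then show ?case by simp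
  next
    case (Suc k)
    show ?case
    proof (rule ccontr)
      assume "\<not> 0 \<le> b (c F) (c F)"
      then have neg: "b (c F) (c F) < 0" by simp
      \<comment> \<open>The times in \<open>I\<close> at which \<open>F\<close> is semistable. This
        set is closed by continuity of the phases, open by \<open>negative_semistable_open\<close>
        and nonempty, so it contains the good time \<open>a\<close>.\<close>
      define J where "J = {s \<in> I. pp s F - pm s F = 0}"
      have "closedin (top_of_set I) J"
        unfolding J_def by (rule continuous_closedin_preimage_constant[OF cont[OF Suc.prems(2)]])
      moreover have "openin (top_of_set I) J"
        unfolding openin_euclidean_subtopology_iff
      proof (intro conjI ballI)
        fix s0 assume "s0 \<in> J"
        then have s0: "s0 \<in> I" "pp s0 F = pm s0 F" by (auto simp: J_def)
        have "\<exists>e>0. \<forall>s\<in>I. \<bar>s - s0\<bar> < e \<longrightarrow> pp s F = pm s F"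
        proof (rule negative_semistable_open[where ?Z0.0 = "z t0" and L = L and \<epsilon> = "\<epsilon> / 4"])
          show "pp s F \<le> pp s0 F + 1/6 \<and> pp s0 F - 1/6 \<le> pm s F" if "s \<in> I" for s
          proof -
            have "\<bar>pp s F - pp t0 F\<bar> < 1/12 \<and> \<bar>pm s F - pm t0 F\<bar> < 1/12"
              "\<bar>pp s0 F - pp t0 F\<bar> < 1/12 \<and> \<bar>pm s0 F - pm t0 F\<bar> < 1/12"
              using d1 I that s0(1) Suc.prems(2) by blast+
            then show ?thesis using s0(2) by linarith
          qed
          show "0 \<le> b (c X) (c X)" if "s \<in> I" "X \<in> Obj" "pp s X = pm s X"
              "(norm (z t0 (c X)))\<^sup>2 \<le> (norm (z t0 (c F)))\<^sup>2 - (\<epsilon> / 4)\<^sup>2" for s X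
            using Suc.IH[of s X] that Suc.prems(4) by (simp add: algebra_simps)
        qed (use s0 Suc.prems neg lin[OF t0] I L low sect \<open>\<epsilon> > 0\<close> in \<open>auto simp: L_def\<close>)
        then show "\<exists>e>0. \<forall>x'\<in>I. dist x' s0 < e \<longrightarrow> x' \<in> J"
          by (auto simp: J_def dist_real_def)
      qed (auto simp: J_def)
      ultimately have "J = {} \<or> J = I"
        using \<open>connected I\<close> unfolding connected_clopen by blast
      moreover have "s \<in> J" using Suc.prems by (simp add: J_def)
      ultimately have "a \<in> J" using a(1) by blast
      then show False using a(2) neg Suc.prems(2) unfolding good_def J_def by force
    qed
  qed
  have "good s'" if "s \<in> I" "s' \<in> I" "good s" for s s'
    unfolding good_def
  proof (intro ballI impI)
    fix F assume F: "F \<in> Obj" "pp s' F = pm s' F"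
    obtain k where "(norm (z t0 (c F)))\<^sup>2 < real k * (\<epsilon> / 4)\<^sup>2"
      using ex_less_of_nat_mult[of "(\<epsilon> / 4)\<^sup>2" "(norm (z t0 (c F)))\<^sup>2"] \<open>\<epsilon> > 0\<close> by auto
    then show "0 \<le> b (c F) (c F)" using claim that F by blast
  qed
  then show ?thesis
    using \<open>d > 0\<close> in_I by blast
qed

text \<open>An interval is connected, so a locally constant truth value is constant on it.\<close>

lemma good_constant:
  assumes "is_interval T" "s \<in> T" "t \<in> T" "good s"
  shows "good t"
proof -
  have "good s \<longleftrightarrow> good t"
  proof (rule connected_equivalence_relation[of T s t "\<lambda>s t. good s \<longleftrightarrow> good t"])
    show "connected T" using assms(1) by (simp add: is_interval_connected)
    fix a assume a: "a \<in> T"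
    then obtain \<delta> where "\<delta> > 0" and \<delta>: "\<And>s s'. s \<in> T \<Longrightarrow> s' \<in> T \<Longrightarrow> \<bar>s - a\<bar> < \<delta> \<Longrightarrow> \<bar>s' - a\<bar> < \<delta> \<Longrightarrow> good s \<Longrightarrow> good s'"
      using good_locally_constant assms(1) by meson
    show "\<exists>U. openin (top_of_set T) U \<and> a \<in> U \<and> (\<forall>x\<in>U. good a \<longleftrightarrow> good x)"
    proof (intro exI conjI ballI)
      show "openin (top_of_set T) (T \<inter> ball a \<delta>)" by blast
      show "a \<in> T \<inter> ball a \<delta>" using a \<open>\<delta> > 0\<close> by simp
      show "good a \<longleftrightarrow> good x" if "x \<in> T \<inter> ball a \<delta>" for x
        using \<delta>[of a x] \<delta>[of x a] that a \<open>\<delta> > 0\<close> by (auto simp: dist_real_def abs_minus_commute)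
    qed
  qed (use assms in auto)
  then show ?thesis using assms(4) by simp
qed

end

section \<open>From stability conditions to numerical data\<close>

lemma stability_HN_decomposition:
  fixes D :: "('o, 'm) tri_cat" and cl :: "('o \<Rightarrow>\<^sub>0 int) set \<Rightarrow> 'g::ab_group_add"
  assumes D: "triangulated_category D"
    and stab: "stability_condition D cl N (Z, P)"
    and cl: "cl \<in> hom (K_group D) type_group"
    and \<kappa>: "0 < \<kappa>" "\<And>v. \<kappa> * nu v \<le> N v"
  shows "\<exists>\<epsilon>>0. \<forall>X\<in>{X \<in> Ob D. \<not> zero_object D X}. \<exists>n A \<phi> r.
    HN_decomposition {X \<in> Ob D. \<not> zero_object D X} (\<lambda>X. lattice_incl (cl (K_class D X))) nu
      (real_extension Z) (phase_plus D P) (phase_minus D P) \<epsilon> X n A \<phi> r"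
proof -
  interpret triangulated_category D by fact
  define c where "c X = lattice_incl (cl (K_class D X))" for X
  define W where "W X = real_extension Z (c X)" for X
  have add: "Modules.additive Z" and P: "slicing D P"
    and Z: "\<And>\<phi> E. E \<in> P \<phi> \<Longrightarrow> \<not> zero_object D E \<Longrightarrow>
        \<exists>r>0. Z (cl (K_class D E)) = of_real r * exp (\<i> * of_real (pi * \<phi>))"
    and supp: "\<exists>\<epsilon>>0. \<forall>E. semistable D (Z, P) E \<longrightarrow>
        \<epsilon> * N (lattice_incl (cl (K_class D E))) \<le> cmod (Z (cl (K_class D E)))"
    using stab unfolding stability_condition_def prod.case by blast+
  have W: "W X = Z (cl (K_class D X))" for X
    unfolding W_def c_def by (rule real_extension_additive(2)[OF add])
  obtain \<epsilon> where "\<epsilon> > 0" and \<epsilon>: "\<And>E. semistable D (Z, P) E \<Longrightarrow> \<epsilon> * N (c E) \<le> cmod (W E)"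
    using supp unfolding c_def[symmetric] W[symmetric] by blast
  have "\<exists>n A \<phi> r. HN_decomposition {X \<in> Ob D. \<not> zero_object D X} c nu
      (real_extension Z) (phase_plus D P) (phase_minus D P) (\<epsilon> * \<kappa>) X n A \<phi> r"
    if X: "X \<in> Ob D" "\<not> zero_object D X" for X
  proof -
    obtain n :: nat and A \<phi> where n: "1 \<le> n" "phase_plus D P X = phase_minus D P X \<longleftrightarrow> n = 1"
        "cl (K_class D X) = (\<Sum>k=1..n. cl (K_class D (A k)))"
      and A: "\<And>k. k \<in> {1..n} \<Longrightarrow> A k \<in> P (\<phi> k) \<and> \<not> zero_object D (A k) \<and>
        phase_minus D P X \<le> \<phi> k \<and> \<phi> k \<le> phase_plus D P X"
      using HN_exists[OF P cl X] by blast
    have factor: "A k \<in> {X \<in> Ob D. \<not> zero_object D X} \<and>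
        phase_plus D P (A k) = \<phi> k \<and> phase_minus D P (A k) = \<phi> k \<and>
        phase_minus D P X \<le> \<phi> k \<and> \<phi> k \<le> phase_plus D P X \<and> 0 < cmod (W (A k)) \<and>
        real_extension Z (c (A k)) = of_real (cmod (W (A k))) * exp (\<i> * of_real (pi * \<phi> k)) \<and>
        \<epsilon> * \<kappa> * nu (c (A k)) \<le> cmod (W (A k))"
      if k: "k \<in> {1..n}" for k
    proof -
      have Ak: "A k \<in> P (\<phi> k)" "\<not> zero_object D (A k)" using A[OF k] by auto
      obtain r where r: "r > 0" "W (A k) = of_real r * exp (\<i> * of_real (pi * \<phi> k))"
        using Z[OF Ak] unfolding W by blast
      have "cmod (W (A k)) = r" using r by (simp add: norm_mult)
      then have "0 < cmod (W (A k))"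
        "real_extension Z (c (A k)) = of_real (cmod (W (A k))) * exp (\<i> * of_real (pi * \<phi> k))"
        using r by (simp_all add: W_def)
      \<comment> \<open>The support property is stated for \<open>N\<close>; passing to
        \<open>nu\<close> costs the factor \<kappa>.\<close>
      moreover have "\<epsilon> * \<kappa> * nu (c (A k)) \<le> cmod (W (A k))"
      proof -
        have "semistable D (Z, P) (A k)" using Ak by (auto simp: semistable_def)
        then have "\<epsilon> * N (c (A k)) \<le> cmod (W (A k))" by (rule \<epsilon>)
        moreover have "\<epsilon> * (\<kappa> * nu (c (A k))) \<le> \<epsilon> * N (c (A k))"
          using \<kappa>(2) \<open>\<epsilon> > 0\<close> by (intro mult_left_mono) auto
        ultimately show ?thesis by (simp add: mult.assoc)
      qed
      ultimately show ?thesis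
        using Ak A[OF k] semistable_phases[OF P Ak(2,1)] slicing_Ob[OF P Ak(1)] by blast
    qed
    have "c X = (\<Sum>k=1..n. c (A k))"
      unfolding c_def n(3) by (rule Modules.additive.sum[OF additive_lattice_incl])
    then have "HN_decomposition {X \<in> Ob D. \<not> zero_object D X} c nu (real_extension Z)
        (phase_plus D P) (phase_minus D P) (\<epsilon> * \<kappa>) X n A \<phi> (\<lambda>k. cmod (W (A k)))"
      unfolding HN_decomposition_def using n(1,2) factor by blast
    then show ?thesis by blast
  qed
  moreover have "0 < \<epsilon> * \<kappa>" using \<open>\<epsilon> > 0\<close> \<kappa>(1) by simp
  ultimately show ?thesis unfolding c_def[abs_def] by blast
qed

section \<open>Pullback to a path and conclusion\<close>

theorem theorem3p10:
  fixes D :: "('o, 'm) tri_cat"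
    and cl :: "('o \<Rightarrow>\<^sub>0 int) set \<Rightarrow> 'g::ab_group_add"
    and N :: "'g realification \<Rightarrow> real"
    and M :: "'x topology"
    and \<sigma> :: "'x \<Rightarrow> ('o, 'g) stab"
    and Q :: "'g realification \<Rightarrow> real"
  assumes "triangulated_category D"
    and "free_of_finite_rank TYPE('g)"
    and "cl \<in> hom (K_group D) type_group"
    and "is_norm N"
    and "path_connected_space M"
    and "\<forall>x \<in> topspace M. stability_condition D cl N (\<sigma> x)"
    and "continuous_stab_family D M \<sigma>"
    and "quadratic_form Q"
    and "\<forall>x \<in> topspace M. \<forall>v. real_extension (fst (\<sigma> x)) v = 0 \<longrightarrow> Q v \<le> 0"
    and "\<exists>x \<in> topspace M. \<forall>E. semistable D (\<sigma> x) E \<longrightarrow> Q (lattice_incl (cl (K_class D E))) \<ge> 0"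
  shows "\<forall>y \<in> topspace M. \<forall>E. semistable D (\<sigma> y) E \<longrightarrow> Q (lattice_incl (cl (K_class D E))) \<ge> 0"
proof (intro ballI allI impI)
  interpret triangulated_category D by fact
  obtain x where x: "x \<in> topspace M"
    "\<And>E. semistable D (\<sigma> x) E \<Longrightarrow> Q (lattice_incl (cl (K_class D E))) \<ge> 0"
    using assms(10) by blast
  fix y F assume y: "y \<in> topspace M" and F: "semistable D (\<sigma> y) F"
  obtain g where "pathin M g" and g01: "g 0 = x" "g 1 = y"
    using assms(5) x(1) y unfolding path_connected_space_def by blast
  then have g: "continuous_map (top_of_set {0..1}) M g" by (simp add: pathin_def)
  have gM: "g t \<in> topspace M" if "t \<in> {0..1}" for t
    using continuous_map_image_subset_topspace[OF g] that by auto
  obtain b where b: "bilinear b" "\<And>v w. b v w = b w v" and Qb: "\<And>v. Q v = b v v"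
    using assms(8) unfolding quadratic_form_def by blast
  obtain n and e :: "nat \<Rightarrow> 'g" and xi :: "nat \<Rightarrow> 'g realification \<Rightarrow> real"
    where lin_xi: "\<And>i. linear (xi i)"
      and exp: "\<And>v. v = (\<Sum>i<n. xi i v *\<^sub>R lattice_incl (e i))"
      and dual: "\<And>i j. j < n \<Longrightarrow> xi i (lattice_incl (e j)) = (if i = j then 1 else 0)"
      and int: "\<And>g. g \<noteq> 0 \<Longrightarrow> 1 \<le> (\<Sum>i<n. \<bar>xi i (lattice_incl g)\<bar>)"
    by (rule realification_basis[OF assms(2)]) (rule that)
  \<comment> \<open>This coordinate norm replaces \<open>N\<close>: it is at least 1 on nonzero
    lattice vectors, and \<kappa> carries the support property over.\<close>
  define nu where "nu v = (\<Sum>i<n. \<bar>xi i v\<bar>)" for v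
  have nu_nonneg: "0 \<le> nu v" for v by (simp add: nu_def sum_nonneg)
  obtain \<kappa> where "\<kappa> > 0" and \<kappa>: "\<And>v. \<kappa> * nu v \<le> N v"
    using norm_ge_coordinate_sum[OF assms(4) lin_xi exp dual] by (auto simp: nu_def)
  define Zg where "Zg t = fst (\<sigma> (g t))" for t
  define P where "P t = snd (\<sigma> (g t))" for t
  have \<sigma>: "\<sigma> (g t) = (Zg t, P t)" for t by (simp add: Zg_def P_def)
  define z where "z t = real_extension (Zg t)" for t
  define Obj where "Obj = {X \<in> Ob D. \<not> zero_object D X}"
  define c :: "'o \<Rightarrow> 'g realification" where "c X = lattice_incl (cl (K_class D X))" for X
  define pp where "pp t = phase_plus D (P t)" for t
  define pm where "pm t = phase_minus D (P t)" for t
  have stab_t: "stability_condition D cl N (Zg t, P t)" if "t \<in> {0..1}" for t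
    using assms(6) gM[OF that] by (simp add: \<sigma>[symmetric])
  then have stab: "Modules.additive (Zg t)" "slicing D (P t)" if "t \<in> {0..1}" for t
    using that unfolding stability_condition_def prod.case by blast+
  have lin_z: "linear (z t)" and z_lattice: "z t (lattice_incl h) = Zg t h" if "t \<in> {0..1}" for t h
    using real_extension_additive[OF stab(1)[OF that]] by (auto simp: z_def)
  \<comment> \<open>The space of central charges has the topology of pointwise convergence, so
    evaluation at a fixed lattice element is continuous.\<close>
  have cont_Z: "continuous_on {0..1} (\<lambda>t. Zg t h)" for h
  proof -
    have "continuous_map (top_of_set {0..1}) euclidean (\<lambda>t. fst (\<sigma> (g t)))"
      using continuous_map_compose[OF g, of euclidean "\<lambda>x. fst (\<sigma> x)"] assms(7)
      by (simp add: continuous_stab_family_def o_def)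
    then have "continuous_on {0..1} (\<lambda>t. fst (\<sigma> (g t)))" by simp
    then show ?thesis
      unfolding Zg_def by (rule continuous_on_product_then_coordinatewise)
  qed
  have semi: "X \<in> Obj \<and> pp t X = pm t X \<and> pp t X = \<phi>"
    if "t \<in> {0..1}" "X \<in> P t \<phi>" "\<not> zero_object D X" for t X \<phi>
    using semistable_phases[OF stab(2)[OF that(1)] that(3,2)] slicing_Ob[OF stab(2)[OF that(1)] that(2)] that(3)
    by (simp add: pp_def pm_def Obj_def)
  interpret F: semistable_family "{0..1}" Obj c nu b z pp pm
  proof (rule semistable_family.intro)
    show "nu (v + w) \<le> nu v + nu w" for v w
      unfolding nu_def sum.distrib[symmetric]
      by (intro sum_mono) (simp add: linear_add[OF lin_xi])
    show "nu (r *\<^sub>R v) = \<bar>r\<bar> * nu v" for r v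
      by (simp add: nu_def linear_scale[OF lin_xi] abs_mult sum_distrib_left)
    show "\<exists>B\<ge>0. \<forall>v w. \<bar>b v w\<bar> \<le> B * nu v * nu w"
      unfolding nu_def using bilinear_le_coordinate_sum[OF b(1) exp]
      by (intro exI[of _ "\<Sum>i<n. \<Sum>j<n. \<bar>b (lattice_incl (e j)) (lattice_incl (e i))\<bar>"])
        (simp add: sum_nonneg)
    show "\<exists>L. \<forall>v. cmod (z t v) \<le> L * nu v" if "t \<in> {0..1}" for t
      unfolding nu_def using norm_linear_le_coordinate_sum[OF lin_z[OF that] exp] by blast
    show "b v v \<le> 0" if "t \<in> {0..1}" "z t v = 0" for t v
      using assms(9) gM[OF that(1)] that(2) by (simp add: z_def Zg_def Qb)
    show "1 \<le> nu (c X)" if "c X \<noteq> 0" for X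
    proof -
      have "cl (K_class D X) \<noteq> 0"
        using that Modules.additive.zero[OF additive_lattice_incl] by (metis c_def)
      then show ?thesis unfolding nu_def c_def by (rule int)
    qed
    show "\<exists>\<delta>>0. \<forall>s\<in>{0..1}. \<bar>s - t\<bar> < \<delta> \<longrightarrow> (\<forall>v. cmod (z s v - z t v) \<le> \<eta> * nu v)"
      if t: "t \<in> {0..1}" and \<eta>: "0 < \<eta>" for t \<eta>
    proof -
      \<comment> \<open>Convergence on the finitely many basis vectors, measured by
        \<open>h\<close>, gives convergence on all vectors uniformly relative to
        \<open>nu\<close>.\<close>
      define h where "h s = (\<Sum>i<n. cmod (Zg s (e i) - Zg t (e i)))" for s
      have "continuous_on {0..1} h" unfolding h_def by (intro continuous_intros cont_Z)
      moreover have "h t = 0" by (simp add: h_def)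
      ultimately obtain \<delta> where "\<delta> > 0"
        and "\<forall>s\<in>{0..1}. dist s t < \<delta> \<longrightarrow> dist (h s) 0 < \<eta>"
        using t \<eta> unfolding continuous_on_iff by metis
      then have \<delta>: "h s < \<eta>" if "s \<in> {0..1}" "\<bar>s - t\<bar> < \<delta>" for s
        using that by (fastforce simp: dist_real_def)
      have "cmod (z s v - z t v) \<le> \<eta> * nu v" if s: "s \<in> {0..1}" "\<bar>s - t\<bar> < \<delta>" for s v
      proof -
        have "cmod (z s v - z t v) \<le> h s * nu v"
          using norm_linear_le_coordinate_sum[OF linear_compose_sub[OF lin_z[OF s(1)] lin_z[OF t]] exp, of v]
          by (simp add: h_def nu_def z_lattice s(1) t del: atLeastAtMost_iff)
        also have "\<dots> \<le> \<eta> * nu v" using \<delta>[OF s] nu_nonneg by (intro mult_right_mono) auto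
        finally show ?thesis .
      qed
      then show ?thesis using \<open>\<delta> > 0\<close> by (intro exI[of _ \<delta>]) simp
    qed
    show "\<exists>\<delta>>0. \<forall>s\<in>{0..1}. \<bar>s - t\<bar> < \<delta> \<longrightarrow>
        (\<forall>X\<in>Obj. \<bar>pp s X - pp t X\<bar> < \<theta> \<and> \<bar>pm s X - pm t X\<bar> < \<theta>)"
      if t: "t \<in> {0..1}" and \<theta>: "0 < \<theta>" for t \<theta>
    proof -
      obtain U where U: "openin M U" "g t \<in> U"
        "\<And>y. y \<in> U \<Longrightarrow> slicing_dist D (snd (\<sigma> (g t))) (snd (\<sigma> y)) < ennreal \<theta>"
      proof -
        have "\<forall>x\<in>topspace M. \<forall>\<epsilon>>0. \<exists>U. openin M U \<and> x \<in> U \<and>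
            (\<forall>y\<in>U. slicing_dist D (snd (\<sigma> x)) (snd (\<sigma> y)) < ennreal \<epsilon>)"
          using assms(7) unfolding continuous_stab_family_def by (rule conjunct2)
        from this[rule_format, OF gM[OF t] \<theta>] show ?thesis using that by blast
      qed
      have "openin (top_of_set {0..1}) {s \<in> {0..1}. g s \<in> U}"
        using openin_continuous_map_preimage[OF g U(1)] by simp
      then obtain \<delta> where "\<delta> > 0" and \<delta>: "\<And>s. s \<in> {0..1} \<Longrightarrow> \<bar>s - t\<bar> < \<delta> \<Longrightarrow> g s \<in> U"
        using t U(2) unfolding openin_euclidean_subtopology_iff dist_real_def by auto
      have "\<bar>pp s X - pp t X\<bar> < \<theta> \<and> \<bar>pm s X - pm t X\<bar> < \<theta>"
        if s: "s \<in> {0..1}" "\<bar>s - t\<bar> < \<delta>" and X: "X \<in> Obj" for s X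
      proof -
        have "ennreal (max \<bar>pp t X - pp s X\<bar> \<bar>pm t X - pm s X\<bar>) \<le> slicing_dist D (P t) (P s)"
          unfolding slicing_dist_def pp_def pm_def using X unfolding Obj_def by (intro SUP_upper)
        also have "\<dots> < ennreal \<theta>" using U(3)[OF \<delta>[OF s]] by (simp add: P_def)
        finally show ?thesis using \<theta> by (simp add: ennreal_less_iff abs_minus_commute)
      qed
      then show ?thesis using \<open>\<delta> > 0\<close> by blast
    qed
    show "\<exists>\<epsilon>>0. \<forall>X\<in>Obj. \<exists>n A \<phi> r. HN_decomposition Obj c nu (z t) (pp t) (pm t) \<epsilon> X n A \<phi> r"
      if t: "t \<in> {0..1}" for t
      using stability_HN_decomposition[OF assms(1) stab_t[OF t] assms(3) \<open>\<kappa> > 0\<close> \<kappa>]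
      unfolding Obj_def c_def[abs_def] z_def pp_def pm_def .
    show "bilinear b" "b v w = b w v" for v w by (rule b)+
    show "linear (z t)" if "t \<in> {0..1}" for t by (rule lin_z[OF that])
  qed
  have "F.good 0"
    unfolding F.good_def
  proof (intro ballI impI)
    fix X assume X: "X \<in> Obj" "pp 0 X = pm 0 X"
    have 0: "(0::real) \<in> {0..1}" by simp
    have XO: "X \<in> Ob D" "\<not> zero_object D X" using X by (auto simp: Obj_def)
    obtain m :: nat and A \<phi> where m: "pp 0 X = pm 0 X \<longleftrightarrow> m = 1"
        "cl (K_class D X) = (\<Sum>k=1..m. cl (K_class D (A k)))"
      and A: "\<And>k. k \<in> {1..m} \<Longrightarrow> A k \<in> P 0 (\<phi> k) \<and> \<not> zero_object D (A k)"
      using HN_exists[OF stab(2)[OF 0] assms(3) XO] unfolding pp_def pm_def by blast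
    \<comment> \<open>\<open>X\<close> need not itself belong to any P(\<phi>), as these are not
      assumed closed under isomorphism; its single Harder-Narasimhan factor does, and has the same
      class.\<close>
    have m1: "m = 1" using m(1) X(2) by blast
    have "semistable D (\<sigma> x) (A 1)"
    proof -
      have "A 1 \<in> snd (\<sigma> x) (\<phi> 1)" "\<not> zero_object D (A 1)"
        using A[of 1] m1 by (simp_all add: P_def g01)
      then show ?thesis unfolding semistable_def by blast
    qed
    then show "0 \<le> b (c X) (c X)"
      using x(2)[of "A 1"] m(2) m1 by (simp add: Qb c_def)
  qed
  then have "F.good 1"
    using F.good_constant[of 0 1] by (simp add: is_interval_cc)
  moreover obtain \<phi> where "F \<in> P 1 \<phi>" "\<not> zero_object D F"
    using F \<sigma>[of 1] g01 by (auto simp: semistable_def)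
  ultimately show "0 \<le> Q (lattice_incl (cl (K_class D F)))"
    using semi[of 1 F \<phi>] unfolding F.good_def by (simp add: Qb c_def)
qed

end
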